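(* Assume the following. (i) For any $j\in\{1,\dots,d\}$, the partial derivative $\dot C_j=\partial C/\partial u_j$ exists and is continuous on $V_j=\{\mathbf u\in[0,1]^d:u_j\in(0,1)\}$. (ii) There exists $\kappa>0$ such that, for any $n\in\mathbb N$, $\mathbf x\in(\mathbb R^d)^n$, $\mathbf u\in[0,1]^d$ and $j\in\{1,\dots,d\}$, $\mathrm{Var}(W_{j,u_j}^{\mathbf x})\le\kappa u_j(1-u_j)/n$. (iii) The process $\mathbb B_n(0,\cdot,\cdot)$ converges weakly in $\ell^\infty([0,1]^{d+1})$ to a tight centered Gaussian process $\mathbb Z_C$ concentrated on the set of continuous $f:[0,1]^{d+1}\to\mathbb R$ such that $f(s,\mathbf u)=0$ if one of the components of $(s,\mathbf u)$ is 0, and $f(s,1,\dots,1)=0$ for all $s\in(0,1]$. (iv) There exist positive sequences $b_n\downarrow0$ and $b_n'\downarrow0$ and constants $L_2\ge L_1>0$ such that, for all $n\in\mathbb N$, $b_n+b_n'\ge n^{-1/2}$ and, for any $\mathbf x\in(\mathbb R^d)^n$, $L_1b_n\le h(\mathbf x)\le(L_2b_n)\wedge1/2$ and $L_1b_n'\le h'(\mathbf x)\le(L_2b_n')\wedge1/2$. Then, for any $j\in\{1,\dots,d\}$, $\delta\in(0,1)$ and $\varepsilon\in(0,1/2)$, $$\sup_{(s,t)\in\Lambda,\;t-s\ge\delta}\ \sup_{\mathbf u\in[0,1]^d,\;u_j\in[\varepsilon,1-\varepsilon]}\left|\dot C_{j,\lfloor ns\rfloor+1:\lfloor nt\rfloor}^{\nu,\Delta}(\mathbf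 u)-\dot C_j(\mathbf u)\right|=o_{\Pr}(1),$$ and the same holds with $\dot C^{\nu,\Delta}_{j,\lfloor ns\rfloor+1:\lfloor nt\rfloor}$ replaced by each of $\dot C^{\nu,\nabla}_{j,\lfloor ns\rfloor+1:\lfloor nt\rfloor}$, $\underline{\dot C}^{\nu,\nabla}_{j,\lfloor ns\rfloor+1:\lfloor nt\rfloor}$ and $\underline{\dot C}^{\nu,\Delta}_{j,\lfloor ns\rfloor+1:\lfloor nt\rfloor}$.
   Context: Setting. $(\mathbf X_i)_{i\in\mathbb Z}$ is a $d$-dimensional stationary time series of continuous random vectors $\mathbf X_i=(X_{i1},\dots,X_{id})$ with d.f. $F$, continuous univariate margins $F_1,\dots,F_d$, and unique copula $C$. For $1\le k\le l\le n$, $\mathcal X_{k:l}=(\mathbf X_k,\dots,\mathbf X_l)$. Inequalities between vectors are componentwise; $\wedge$, $\vee$ are (componentwise) minimum and maximum. All limits are as $n\to\infty$; weak convergence is in the sense of van der Vaart and Wellner (1996, Definition 1.3.3); $\ell^\infty(T)$ is the space of bounded real functions on $T$ with the uniform metric. $\Lambda=\{(s,t)\in[0,1]^2:s\le t\}$. $\dot C_j$ is set to 0 on $\{\mathbf u\in[0,1]^d:u_j\in\{0,1\}\}$. With $\mathbf U_i=(F_1(X_{i1}),\dots,F_d(X_{id}))$, $\mathbb B_n(s,t,\mathbf u)=n^{-1/2}\sum_{i=\lfloor ns\rfloor+1}^{\lfloor nt\rfloor}\{\mathbf 1(\mathbf U_i\le\mathbf u)-C(\mathbf u)\}$ (zero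 for empty sums). Empirical copula. $R_{ij}^{k:l}=\sum_{t=k}^l\mathbf 1(X_{tj}\le X_{ij})$, $\mathbf R_i^{k:l}=(R_{i1}^{k:l},\dots,R_{id}^{k:l})$, $C_{k:l}(\mathbf u)=\frac1{l-k+1}\sum_{i=k}^l\mathbf 1\{\mathbf R_i^{k:l}/(l-k+1)\le\mathbf u\}$, and $C_{k:l}=0$ if $k>l$. Smoothing. For $m\in\mathbb N$, $\mathbf x\in(\mathbb R^d)^m$, $\mathbf u\in[0,1]^d$, $\nu_{\mathbf u}^{\mathbf x}$ is the law of a $[0,1]^d$-valued random vector $\mathbf W_{\mathbf u}^{\mathbf x}=(W_{1,u_1}^{\mathbf x},\dots,W_{d,u_d}^{\mathbf x})$ with mean $\mathbf u$, whose $j$th component depends on $\mathbf u$ only through $u_j$. Standing assumption: there are a fixed integer $p\ge d$, a random vector $\mathbf U$ with $p$ independent standard uniform components, independent of $\mathcal X_{1:n}$, and functions $\mathcal W_{\mathbf u}^{\mathbf x}:[0,1]^p\to[0,1]^d$ with $\mathbf W_{\mathbf u}^{\mathbf x}=\mathcal W_{\mathbf u}^{\mathbf x}(\mathbf U)$. $\nu_{\mathbf u}^{\mathcal X_{k:l}}$ denotes $\nu_{\mathbf u}^{\mathbf x}$ with $\mathbf x=\mathcal X_{k:l}$ (the Dirac measure at $\mathbf u$ if $k>l$). $C_{k:l}^\nu(\mathbf u)=\int_{[0,1]^d}C_{k:l}(\mathbf w)\,d\nu_{\mathbf u}^{\mathcal X_{k:l}}(\mathbf w)$ ($=0$ if $k>l$).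 Estimators. For any $n\in\mathbb N$ and potential data set $\mathbf x\in(\mathbb R^d)^n$, $h(\mathbf x),h'(\mathbf x)\in[0,1/2]$ are the right and left bandwidths for the data set $\mathbf x$. Below, for a stretch $\mathcal X_{k:l}$, $h=h(\mathcal X_{k:l})$ and $h'=h'(\mathcal X_{k:l})$ (random variables, $h+h'>0$); $\mathbf e_j$ is the $j$th canonical basis vector of $\mathbb R^d$, $\mathbf 0=(0,\dots,0)$, $\mathbf 1=(1,\dots,1)$: $$\dot C_{j,k:l}^{\nu,\nabla}(\mathbf u)=\frac{C_{k:l}^\nu\{(\mathbf u+h\mathbf e_j)\wedge\mathbf 1\}-C_{k:l}^\nu\{(\mathbf u-h'\mathbf e_j)\vee\mathbf 0\}}{h+h'},$$ $$\dot C_{j,k:l}^{\nu,\Delta}(\mathbf u)=\frac{C_{k:l}^\nu\{(\mathbf u+h\mathbf e_j)\wedge\mathbf 1\}-C_{k:l}^\nu\{(\mathbf u-h'\mathbf e_j)\vee\mathbf 0\}}{(u_j+h)\wedge1-(u_j-h')\vee0},$$ $\underline{\dot C}_{j,k:l}^{\nu,\nabla}=(\dot C_{j,k:l}^{\nu,\nabla}\vee0)\wedge1$ and $\underline{\dot C}_{j,k:l}^{\nu,\Delta}=(\dot C_{j,k:l}^{\nu,\Delta}\vee0)\wedge1$. *)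

theory Defs
  imports "HOL-Probability.Probability"
begin

text \<open>
  The ambient dimension d is the cardinality of the index type \<open>'d\<close>. The order and the lattice
  operations on \<open>real ^ 'd\<close> are componentwise, so \<open>cbox 0 1\<close> is the unit cube.
\<close>

section \<open>Weak convergence of arbitrary maps into a metric space\<close>

definition borel_of_metric :: "'b metric \<Rightarrow> 'b measure" where
  "borel_of_metric m = sigma (mspace m) {V. openin (mtopology_of m) V}"

text \<open>
  For bounded \<open>T\<close> and a probability measure, restricting the majorants to real-valued
  integrable functions yields the same infimum as admitting all extended-real measurable
  majorants whose expectation exists.
\<close>

definition outer_expectation :: "'a measure \<Rightarrow> ('a \<Rightarrow> real) \<Rightarrow> real" where
  "outer_expectation M T =
     Inf {integral\<^sup>L M V | V. integrable M V \<and> (\<forall>\<omega>\<in>space M. T \<omega> \<le> V \<omega>)}"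

text \<open>The maps \<open>Z n\<close> are not required to be measurable; \<open>L\<close> is a Borel probability measure.\<close>

definition weakly_converges :: "'a measure \<Rightarrow> (nat \<Rightarrow> 'a \<Rightarrow> 'b) \<Rightarrow> 'b metric \<Rightarrow> 'b measure \<Rightarrow> bool" where
  "weakly_converges M Z m L \<longleftrightarrow>
     (\<forall>f. continuous_map (mtopology_of m) euclideanreal f \<and> bounded (f ` mspace m) \<longrightarrow>
        (\<lambda>n. outer_expectation M (\<lambda>\<omega>. f (Z n \<omega>))) \<longlonglongrightarrow> integral\<^sup>L L f)"

definition tight_law :: "'b metric \<Rightarrow> 'b measure \<Rightarrow> bool" where
  "tight_law m L \<longleftrightarrow>
     (\<forall>e>0. \<exists>K. compactin (mtopology_of m) K \<and> measure L K \<ge> 1 - e)"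

text \<open>Convergence to 0 in (outer) probability.\<close>

definition small_o_Pr :: "'a measure \<Rightarrow> (nat \<Rightarrow> 'a \<Rightarrow> ereal) \<Rightarrow> bool" where
  "small_o_Pr M Y \<longleftrightarrow>
     (\<forall>\<eta>>0. (\<lambda>n. outer_measure_of M {\<omega> \<in> space M. ereal \<eta> < \<bar>Y n \<omega>\<bar>}) \<longlonglongrightarrow> 0)"

text \<open>The space of bounded real functions on \<open>T\<close> (extensional outside \<open>T\<close>), uniform metric.\<close>

definition linf :: "'c set \<Rightarrow> ('c \<Rightarrow> real) metric" where
  "linf T = funspace T euclidean_metric"

text \<open>Degenerate normal laws are included.\<close>

definition centered_normal_law :: "real measure \<Rightarrow> bool" where
  "centered_normal_law N \<longleftrightarrow>
     N = return borel 0 \<or> (\<exists>\<sigma>>0. N = density lborel (\<lambda>x. ennreal (normal_density 0 \<sigma> x)))"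

text \<open>Law on \<open>linf T\<close> of a centered Gaussian process: finite-dimensional distributions are
  centered multivariate normal, i.e. all their linear combinations are centered normal.\<close>

definition centered_gaussian_law :: "'c set \<Rightarrow> ('c \<Rightarrow> real) measure \<Rightarrow> bool" where
  "centered_gaussian_law T L \<longleftrightarrow>
     (\<forall>I a. finite I \<and> I \<subseteq> T \<longrightarrow>
        centered_normal_law (distr L borel (\<lambda>f. \<Sum>t\<in>I. a t * f t)))"

text \<open>\<open>[0,1]\<^sup>d\<^sup>+\<^sup>1\<close>, with the time coordinate split off.\<close>

definition unit_cube_time :: "(real \<times> (real ^ 'd)) set" where
  "unit_cube_time = {0..1} \<times> cbox 0 1"


section \<open>Time series, margins and copula\<close>

definition strictly_stationary :: "'a measure \<Rightarrow> (int \<Rightarrow> 'a \<Rightarrow> real ^ 'd) \<Rightarrow> bool" where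
  "strictly_stationary M X \<longleftrightarrow>
     (\<forall>r. distr M (PiM UNIV (\<lambda>_. borel)) (\<lambda>\<omega> i. X (i + r) \<omega>)
        = distr M (PiM UNIV (\<lambda>_. borel)) (\<lambda>\<omega> i. X i \<omega>))"

definition joint_df :: "'a measure \<Rightarrow> ('a \<Rightarrow> real ^ 'd) \<Rightarrow> real ^ 'd \<Rightarrow> real" where
  "joint_df M Y x = measure M {\<omega> \<in> space M. Y \<omega> \<le> x}"

definition margin_df :: "'a measure \<Rightarrow> ('a \<Rightarrow> real ^ 'd) \<Rightarrow> 'd \<Rightarrow> real \<Rightarrow> real" where
  "margin_df M Y j = cdf (distr M borel (\<lambda>\<omega>. Y \<omega> $ j))"

text \<open>A copula is the restriction to the unit cube of a d.f. with standard uniform margins.\<close>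

definition is_copula :: "(real ^ 'd \<Rightarrow> real) \<Rightarrow> bool" where
  "is_copula C \<longleftrightarrow>
     (\<exists>\<mu>. prob_space \<mu> \<and> sets \<mu> = sets borel \<and>
        (\<forall>j. distr \<mu> borel (\<lambda>w. w $ j) = uniform_measure lborel {0..1}) \<and>
        (\<forall>u\<in>cbox 0 1. C u = measure \<mu> {w. w \<le> u}))"

text \<open>\<open>C\<close> is a copula of \<open>Y\<close> (the unique one when the margins are continuous).\<close>

definition copula_of :: "'a measure \<Rightarrow> ('a \<Rightarrow> real ^ 'd) \<Rightarrow> (real ^ 'd \<Rightarrow> real) \<Rightarrow> bool" where
  "copula_of M Y C \<longleftrightarrow>
     is_copula C \<and> (\<forall>x. joint_df M Y x = C (\<chi> j. margin_df M Y j (x $ j)))"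

definition partial_region :: "'d \<Rightarrow> (real ^ 'd) set" where
  "partial_region j = {u \<in> cbox 0 1. u $ j \<in> {0<..<1}}"

definition partial_deriv :: "(real ^ 'd \<Rightarrow> real) \<Rightarrow> 'd \<Rightarrow> real ^ 'd \<Rightarrow> real" where
  "partial_deriv C j u =
     (if u $ j \<in> {0, 1} then 0 else deriv (\<lambda>r. C (u + r *\<^sub>R axis j 1)) 0)"

definition pseudo_obs :: "'a measure \<Rightarrow> (int \<Rightarrow> 'a \<Rightarrow> real ^ 'd) \<Rightarrow> int \<Rightarrow> 'a \<Rightarrow> real ^ 'd" where
  "pseudo_obs M X i \<omega> = (\<chi> j. margin_df M (X i) j (X i \<omega> $ j))"

definition seq_emp_process ::
  "'a measure \<Rightarrow> (real ^ 'd \<Rightarrow> real) \<Rightarrow> (int \<Rightarrow> 'a \<Rightarrow> real ^ 'd) \<Rightarrow> nat \<Rightarrow> 'a \<Rightarrow> real \<Rightarrow> real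
     \<Rightarrow> real ^ 'd \<Rightarrow> real" where
  "seq_emp_process M C X n \<omega> s t u =
     (1 / sqrt (real n)) *
     (\<Sum>i\<in>{\<lfloor>real n * s\<rfloor> + 1..\<lfloor>real n * t\<rfloor>}. of_bool (pseudo_obs M X i \<omega> \<le> u) - C u)"


section \<open>Empirical and smoothed empirical copulas of a stretch\<close>

text \<open>Below, \<open>x\<close> is a realized path of the series; data sets are nonempty lists of vectors.\<close>

definition stretch :: "(int \<Rightarrow> real ^ 'd) \<Rightarrow> int \<Rightarrow> int \<Rightarrow> (real ^ 'd) list" where
  "stretch x k l = map x [k..l]"

definition ranks :: "(int \<Rightarrow> real ^ 'd) \<Rightarrow> int \<Rightarrow> int \<Rightarrow> int \<Rightarrow> real ^ 'd" where
  "ranks x k l i = (\<chi> j. \<Sum>t\<in>{k..l}. of_bool (x t $ j \<le> x i $ j))"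

definition emp_copula :: "(int \<Rightarrow> real ^ 'd) \<Rightarrow> int \<Rightarrow> int \<Rightarrow> real ^ 'd \<Rightarrow> real" where
  "emp_copula x k l u =
     (if k > l then 0
      else (1 / real_of_int (l - k + 1)) *
        (\<Sum>i\<in>{k..l}. of_bool ((1 / real_of_int (l - k + 1)) *\<^sub>R ranks x k l i \<le> u)))"

text \<open>
  \<open>U\<close> is uniform on the \<open>p\<close>-dimensional unit cube (\<open>p = CARD('p) \<ge> d\<close>) and independent of the
  series; \<open>W x u\<close> is the function with which the smoothing vector at \<open>u\<close> for the data set \<open>x\<close>
  is generated from \<open>U\<close>. Independence is that of the generated \<open>\<sigma>\<close>-algebras, since
  \<open>indep_var\<close> requires both random variables to have the same type.
\<close>

definition smoothing_scheme ::
  "'a measure \<Rightarrow> (int \<Rightarrow> 'a \<Rightarrow> real ^ 'd) \<Rightarrow> ('a \<Rightarrow> real ^ 'p)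
     \<Rightarrow> ((real ^ 'd) list \<Rightarrow> real ^ 'd \<Rightarrow> real ^ 'p \<Rightarrow> real ^ 'd) \<Rightarrow> bool" where
  "smoothing_scheme M X U W \<longleftrightarrow>
     CARD('d) \<le> CARD('p) \<and>
     U \<in> borel_measurable M \<and> (\<forall>\<omega>\<in>space M. U \<omega> \<in> cbox 0 1) \<and>
     prob_space.indep_vars M (\<lambda>_. borel) (\<lambda>i \<omega>. U \<omega> $ i) UNIV \<and>
     (\<forall>i. distr M borel (\<lambda>\<omega>. U \<omega> $ i) = uniform_measure lborel {0..1}) \<and>
     (\<forall>n. prob_space.indep_set M
        (sets (vimage_algebra (space M) U borel))
        (sets (vimage_algebra (space M) (\<lambda>\<omega>. \<lambda>i\<in>{1..int n}. X i \<omega>)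
           (PiM {1..int n} (\<lambda>_. borel))))) \<and>
     (\<forall>x. x \<noteq> [] \<longrightarrow> (\<forall>u\<in>cbox 0 1.
        (\<forall>v\<in>cbox 0 1. W x u v \<in> cbox 0 1) \<and>
        (\<lambda>\<omega>. W x u (U \<omega>)) \<in> borel_measurable M \<and>
        integral\<^sup>L M (\<lambda>\<omega>. W x u (U \<omega>)) = u \<and>
        (\<forall>u'\<in>cbox 0 1. \<forall>j. u $ j = u' $ j \<longrightarrow>
           (\<forall>v\<in>cbox 0 1. W x u v $ j = W x u' v $ j))))"

definition smoothing_law ::
  "'a measure \<Rightarrow> ('a \<Rightarrow> real ^ 'p) \<Rightarrow> ((real ^ 'd) list \<Rightarrow> real ^ 'd \<Rightarrow> real ^ 'p \<Rightarrow> real ^ 'd)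
     \<Rightarrow> (real ^ 'd) list \<Rightarrow> real ^ 'd \<Rightarrow> (real ^ 'd) measure" where
  "smoothing_law M U W x u =
     (if x = [] then return borel u else distr M borel (\<lambda>\<omega>. W x u (U \<omega>)))"

text \<open>The smoothing laws enter only as a family \<open>\<nu>\<close> of measures indexed by data set and point.\<close>

definition smooth_emp_copula ::
  "((real ^ 'd) list \<Rightarrow> real ^ 'd \<Rightarrow> (real ^ 'd) measure)
     \<Rightarrow> (int \<Rightarrow> real ^ 'd) \<Rightarrow> int \<Rightarrow> int \<Rightarrow> real ^ 'd \<Rightarrow> real" where
  "smooth_emp_copula \<nu> x k l u =
     (if k > l then 0
      else set_lebesgue_integral (\<nu> (stretch x k l) u) (cbox 0 1) (emp_copula x k l))"


section \<open>Estimators of the partial derivatives\<close>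

definition smooth_increment ::
  "((real ^ 'd) list \<Rightarrow> real ^ 'd \<Rightarrow> (real ^ 'd) measure) \<Rightarrow> real \<Rightarrow> real
     \<Rightarrow> (int \<Rightarrow> real ^ 'd) \<Rightarrow> 'd \<Rightarrow> int \<Rightarrow> int \<Rightarrow> real ^ 'd \<Rightarrow> real" where
  "smooth_increment \<nu> r r' x j k l u =
     smooth_emp_copula \<nu> x k l (inf (u + r *\<^sub>R axis j 1) 1)
     - smooth_emp_copula \<nu> x k l (sup (u - r' *\<^sub>R axis j 1) 0)"

definition deriv_est_nabla ::
  "((real ^ 'd) list \<Rightarrow> real ^ 'd \<Rightarrow> (real ^ 'd) measure)
     \<Rightarrow> ((real ^ 'd) list \<Rightarrow> real) \<Rightarrow> ((real ^ 'd) list \<Rightarrow> real)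
     \<Rightarrow> (int \<Rightarrow> real ^ 'd) \<Rightarrow> 'd \<Rightarrow> int \<Rightarrow> int \<Rightarrow> real ^ 'd \<Rightarrow> real" where
  "deriv_est_nabla \<nu> h h' x j k l u =
     (let r = h (stretch x k l); r' = h' (stretch x k l)
      in smooth_increment \<nu> r r' x j k l u / (r + r'))"

definition deriv_est_delta ::
  "((real ^ 'd) list \<Rightarrow> real ^ 'd \<Rightarrow> (real ^ 'd) measure)
     \<Rightarrow> ((real ^ 'd) list \<Rightarrow> real) \<Rightarrow> ((real ^ 'd) list \<Rightarrow> real)
     \<Rightarrow> (int \<Rightarrow> real ^ 'd) \<Rightarrow> 'd \<Rightarrow> int \<Rightarrow> int \<Rightarrow> real ^ 'd \<Rightarrow> real" where
  "deriv_est_delta \<nu> h h' x j k l u =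
     (let r = h (stretch x k l); r' = h' (stretch x k l)
      in smooth_increment \<nu> r r' x j k l u / (min (u $ j + r) 1 - max (u $ j - r') 0))"

definition deriv_est_nabla_trunc ::
  "((real ^ 'd) list \<Rightarrow> real ^ 'd \<Rightarrow> (real ^ 'd) measure)
     \<Rightarrow> ((real ^ 'd) list \<Rightarrow> real) \<Rightarrow> ((real ^ 'd) list \<Rightarrow> real)
     \<Rightarrow> (int \<Rightarrow> real ^ 'd) \<Rightarrow> 'd \<Rightarrow> int \<Rightarrow> int \<Rightarrow> real ^ 'd \<Rightarrow> real" where
  "deriv_est_nabla_trunc \<nu> h h' x j k l u = min (max (deriv_est_nabla \<nu> h h' x j k l u) 0) 1"

definition deriv_est_delta_trunc ::
  "((real ^ 'd) list \<Rightarrow> real ^ 'd \<Rightarrow> (real ^ 'd) measure)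
     \<Rightarrow> ((real ^ 'd) list \<Rightarrow> real) \<Rightarrow> ((real ^ 'd) list \<Rightarrow> real)
     \<Rightarrow> (int \<Rightarrow> real ^ 'd) \<Rightarrow> 'd \<Rightarrow> int \<Rightarrow> int \<Rightarrow> real ^ 'd \<Rightarrow> real" where
  "deriv_est_delta_trunc \<nu> h h' x j k l u = min (max (deriv_est_delta \<nu> h h' x j k l u) 0) 1"

text \<open>
  Uniform error of an estimator \<open>D\<close> over stretches of relative length at least \<open>\<delta>\<close> and points
  with \<open>j\<close>th coordinate in \<open>[\<epsilon>, 1 - \<epsilon>]\<close>. The suprema are taken in \<open>ereal\<close>, so they are
  meaningful without a boundedness argument.
\<close>

definition sup_error ::
  "(real ^ 'd \<Rightarrow> real) \<Rightarrow> (int \<Rightarrow> 'a \<Rightarrow> real ^ 'd)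
     \<Rightarrow> ((int \<Rightarrow> real ^ 'd) \<Rightarrow> 'd \<Rightarrow> int \<Rightarrow> int \<Rightarrow> real ^ 'd \<Rightarrow> real)
     \<Rightarrow> 'd \<Rightarrow> real \<Rightarrow> real \<Rightarrow> nat \<Rightarrow> 'a \<Rightarrow> ereal" where
  "sup_error C X D j \<delta> \<epsilon> n \<omega> =
     (SUP (s, t)\<in>{(s, t). 0 \<le> s \<and> s \<le> t \<and> t \<le> 1 \<and> \<delta> \<le> t - s}.
       SUP u\<in>{u \<in> cbox 0 1. u $ j \<in> {\<epsilon>..1 - \<epsilon>}}.
         ereal \<bar>D (\<lambda>i. X i \<omega>) j (\<lfloor>real n * s\<rfloor> + 1) \<lfloor>real n * t\<rfloor> u - partial_deriv C j u\<bar>)"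

end

theory Submission
  imports Defs "HOL-Real_Asymp.Real_Asymp"
begin

text \<open>
  Consider a stretch of length \<open>m\<close> of order \<open>n\<close>, and write \<open>H\<close> for the empirical d.f. of its
  pseudo-observations. Its empirical copula at \<open>u\<close> is \<open>H\<close> at the vector of rank quantiles of \<open>u\<close>
  (lemma \<open>emp_copula_eq_edf\<close>). The estimators divide an increment of the smoothed empirical copula
  in coordinate \<open>j\<close> by the total bandwidth \<open>r + r'\<close>, which is at least of order \<open>1 / sqrt m\<close>. So it
  suffices to know increments of the empirical copula up to \<open>o (1 / sqrt m)\<close>, and two facts give
  this.

  First, \<open>sqrt m * (H - C)\<close> is, up to a bounded factor, a difference of two values in time of the
  sequential empirical process. As this process converges weakly to one with continuous paths,
  it is bounded in probability and asymptotically equicontinuous (\<open>weak_limit_bounded\<close> and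
  \<open>weak_limit_equicontinuous\<close>): continuous functionals that measure oscillation have small means
  under the limit law, hence small outer means along the sequence.

  Second, two points that differ in coordinate \<open>j\<close> only have quantile vectors that differ in
  coordinate \<open>j\<close> only. The increment of \<open>H\<close> between these is an oscillation of \<open>H - C\<close> plus an
  increment of \<open>C\<close>, to which the mean value theorem in coordinate \<open>j\<close> applies near the interior
  point under consideration (\<open>emp_copula_increment_linear\<close>). The quantile vector needs to be close
  to its argument only to evaluate the derivative, and the rate matters only for increments in
  coordinate \<open>j\<close>, where it follows from equicontinuity (\<open>quantile_increment\<close>).

  Smoothing preserves this structure, since the smoothing vectors at the two shifted points come
  from the same uniform vector and share all coordinates but the \<open>j\<close>th. Their \<open>j\<close>th coordinates
  differ by \<open>r + r'\<close> in mean and, by the variance bound, by a multiple of \<open>r + r'\<close> in mean square,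
  while with high probability both vectors are near \<open>u\<close>; so the linear approximation can be
  integrated (\<open>smooth_increment_error\<close>). Away from 0 and 1 the two denominators agree for large
  \<open>n\<close>, and truncation to \<open>[0,1]\<close> does not increase the error because the derivative of a copula is
  in \<open>[0,1]\<close>.

  All this holds for paths on which ranks can be computed from the pseudo-observations, which is
  almost surely the case although the margins may have flat pieces (\<open>AE_pseudo_obs\<close>).
\<close>

section \<open>Oscillation of weakly convergent processes\<close>

text \<open>
  Every integrable majorant of \<open>T\<close> obeys the usual Markov inequality, and its level sets are
  measurable covers of those of \<open>T\<close>; the infimum over the majorants gives the bound.
\<close>

lemma Markov_outer_expectation:
  assumes "prob_space M" and T: "\<And>\<omega>. 0 \<le> T \<omega>" "\<And>\<omega>. T \<omega> \<le> 1" and "a > 0"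
  shows "outer_measure_of M {\<omega> \<in> space M. a \<le> T \<omega>} \<le> ennreal (outer_expectation M T / a)"
proof -
  interpret prob_space M by fact
  let ?A = "{\<omega> \<in> space M. a \<le> T \<omega>}"
  have "outer_measure_of M ?A \<le> outer_measure_of M (space M)"
    by (rule outer_measure_of_mono) auto
  then have fin: "outer_measure_of M ?A < \<infinity>"
    by (simp add: emeasure_space_1 order_le_less_trans)
  define p where "p = enn2real (outer_measure_of M ?A)"
  have p: "outer_measure_of M ?A = ennreal p" "0 \<le> p"
    using fin by (auto simp: p_def less_top)
  have "a * p \<le> outer_expectation M T"
    unfolding outer_expectation_def
  proof (rule cInf_greatest)
    show "{integral\<^sup>L M V |V. integrable M V \<and> (\<forall>\<omega>\<in>space M. T \<omega> \<le> V \<omega>)} \<noteq> {}"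
      using T(2) integrable_const[of 1] by blast
    fix v assume "v \<in> {integral\<^sup>L M V |V. integrable M V \<and> (\<forall>\<omega>\<in>space M. T \<omega> \<le> V \<omega>)}"
    then obtain V where V: "integrable M V" "\<And>\<omega>. \<omega> \<in> space M \<Longrightarrow> T \<omega> \<le> V \<omega>" "v = integral\<^sup>L M V"
      by auto
    note [measurable] = borel_measurable_integrable[OF V(1)]
    have V0: "AE \<omega> in M. 0 \<le> V \<omega>"
      using V(2) T(1) by (intro AE_I2) (meson order_trans)
    have "ennreal p \<le> outer_measure_of M {\<omega> \<in> space M. a \<le> V \<omega>}"
      unfolding p(1)[symmetric] using V(2) by (intro outer_measure_of_mono) force
    also have "\<dots> = emeasure M {\<omega> \<in> space M. a \<le> V \<omega>}"
      by (rule outer_measure_of_eq) measurable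
    also have "\<dots> \<le> ennreal (1 / a * v)"
      using integral_Markov_inequality[OF V(1) V0 \<open>a > 0\<close>] V(3) by simp
    finally have "p \<le> 1 / a * v"
      using \<open>a > 0\<close> V0 V(3) p(2) by (simp add: ennreal_le_iff integral_nonneg_AE)
    then show "a * p \<le> v"
      using \<open>a > 0\<close> by (simp add: field_simps)
  qed
  then have "p \<le> outer_expectation M T / a"
    using \<open>a > 0\<close> by (simp add: field_simps)
  then show ?thesis
    unfolding p(1) by (rule ennreal_leI)
qed

text \<open>
  \<open>I\<close> is a set of pairs of index points. With \<open>I\<close> the pairs at distance at most \<open>\<eta>\<close> and \<open>c = 1\<close>
  this is a truncated modulus of continuity; with \<open>I = T \<times> {x0}\<close> and \<open>c\<close> small it measures
  boundedness. Truncating at 1 inside the supremum makes the functional bounded and keeps the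
  supremum meaningful for unbounded \<open>f\<close>.
\<close>

definition trunc_osc :: "('c \<times> 'c) set \<Rightarrow> real \<Rightarrow> ('c \<Rightarrow> real) \<Rightarrow> real" where
  "trunc_osc I c f = (SUP (p, q)\<in>I. min 1 (c * \<bar>f p - f q\<bar>))"

lemma trunc_osc_bdd:
  fixes c :: real
  shows "bdd_above ((\<lambda>(p, q). min 1 (c * \<bar>f p - f q\<bar>)) ` I)"
  by (rule bdd_aboveI[of _ 1]) (auto simp: min_le_iff_disj)

lemma le_trunc_osc: "(p, q) \<in> I \<Longrightarrow> min 1 (c * \<bar>f p - f q\<bar>) \<le> trunc_osc I c f"
  unfolding trunc_osc_def using trunc_osc_bdd by (rule cSUP_upper2) auto

lemma trunc_osc_le:
  "I \<noteq> {} \<Longrightarrow> (\<And>p q. (p, q) \<in> I \<Longrightarrow> min 1 (c * \<bar>f p - f q\<bar>) \<le> z) \<Longrightarrow> trunc_osc I c f \<le> z"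
  unfolding trunc_osc_def by (rule cSUP_least) auto

lemma trunc_osc_nonneg:
  assumes "I \<noteq> {}" "0 \<le> c"
  shows "0 \<le> trunc_osc I c f"
proof -
  obtain p q where pq: "(p, q) \<in> I"
    using \<open>I \<noteq> {}\<close> by auto
  have "0 \<le> min 1 (c * \<bar>f p - f q\<bar>)"
    using \<open>0 \<le> c\<close> by simp
  also have "\<dots> \<le> trunc_osc I c f"
    by (rule le_trunc_osc[OF pq])
  finally show ?thesis .
qed

lemma trunc_osc_le_1: "I \<noteq> {} \<Longrightarrow> trunc_osc I c f \<le> 1"
  by (rule trunc_osc_le) (auto simp: min_le_iff_disj)

text \<open>
  The functional is Lipschitz for the uniform metric, because each \<open>\<bar>f p - f q\<bar>\<close> moves by at most
  twice the uniform distance. It is therefore an admissible test function for weak convergence.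
\<close>

lemma continuous_trunc_osc:
  assumes "I \<noteq> {}" "I \<subseteq> T \<times> T" "0 \<le> c"
  shows "continuous_map (mtopology_of (linf T)) euclideanreal (trunc_osc I c)"
proof -
  have T: "T \<noteq> {}" using assms by auto
  have le: "trunc_osc I c f \<le> trunc_osc I c g + 2 * c * mdist (linf T) f g"
    if fg: "f \<in> mspace (linf T)" "g \<in> mspace (linf T)" for f g
  proof (rule trunc_osc_le[OF \<open>I \<noteq> {}\<close>])
    fix p q assume pq: "(p, q) \<in> I"
    have d: "\<bar>f x - g x\<bar> \<le> mdist (linf T) f g" if "x \<in> T" for x
      using funspace_mdist_le[of f T euclidean_metric g "mdist (linf T) f g"] fg T that
      by (simp add: linf_def dist_real_def)
    have "\<bar>f p - f q\<bar> \<le> \<bar>g p - g q\<bar> + 2 * mdist (linf T) f g"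
      using d[of p] d[of q] pq assms(2) by auto
    then have "c * \<bar>f p - f q\<bar> \<le> c * \<bar>g p - g q\<bar> + 2 * c * mdist (linf T) f g"
      using mult_left_mono[OF _ \<open>0 \<le> c\<close>] by (fastforce simp: algebra_simps)
    moreover have "0 \<le> 2 * c * mdist (linf T) f g"
      using \<open>0 \<le> c\<close> by simp
    ultimately show "min 1 (c * \<bar>f p - f q\<bar>) \<le> trunc_osc I c g + 2 * c * mdist (linf T) f g"
      using le_trunc_osc[OF pq, of c g] by linarith
  qed
  have "Lipschitz_continuous_map (linf T) euclidean_metric (trunc_osc I c)"
    unfolding Lipschitz_continuous_map_def
  proof (intro conjI exI ballI)
    fix f g assume fg: "f \<in> mspace (linf T)" "g \<in> mspace (linf T)"
    show "mdist euclidean_metric (trunc_osc I c f) (trunc_osc I c g) \<le> 2 * c * mdist (linf T) f g"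
      using le[OF fg] le[OF fg(2,1)] mdist_commute[of "linf T" f g]
      by (simp add: dist_real_def)
  qed simp
  then show ?thesis
    using Lipschitz_continuous_imp_continuous_map by force
qed

lemma continuous_map_borel_of_metric:
  fixes f :: "'b \<Rightarrow> real"
  assumes "continuous_map (mtopology_of m) euclideanreal f" and "sets L = sets (borel_of_metric m)"
  shows "f \<in> borel_measurable L"
proof (rule borel_measurableI)
  have op: "{V. openin (mtopology_of m) V} \<subseteq> Pow (mspace m)"
    using openin_subset[of "mtopology_of m"] by auto
  have sp: "space L = mspace m"
    using sets_eq_imp_space_eq[OF assms(2)] by (simp add: borel_of_metric_def space_measure_of_conv)
  fix S :: "real set" assume "open S"
  then have "openin (mtopology_of m) {x \<in> topspace (mtopology_of m). f x \<in> S}"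
    using assms(1) openin_continuous_map_preimage by fastforce
  moreover have "{x \<in> topspace (mtopology_of m). f x \<in> S} = f -` S \<inter> space L"
    using sp by auto
  ultimately show "f -` S \<inter> space L \<in> sets L"
    using op assms(2) by (simp add: borel_of_metric_def sets_measure_of)
qed

text \<open>
  By dominated convergence some functional of the sequence has a small mean under the limit law;
  weak convergence carries this over to the outer expectation for large \<open>n\<close>, and the Markov
  inequality turns it into an outer probability.
\<close>

lemma weak_limit_trunc_osc_small:
  assumes "prob_space M" "weakly_converges M Z (linf T) L"
    and "prob_space L" "sets L = sets (borel_of_metric (linf T))"
    and I: "\<And>k. I k \<noteq> {}" "\<And>k. I k \<subseteq> T \<times> T" and c: "\<And>k. 0 \<le> c k"
    and lim: "AE f in L. (\<lambda>k. trunc_osc (I k) (c k) f) \<longlonglongrightarrow> 0"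
    and "0 < a" "0 < e"
  shows "\<exists>k. \<forall>\<^sub>F n in sequentially.
    outer_measure_of M {\<omega> \<in> space M. a \<le> trunc_osc (I k) (c k) (Z n \<omega>)} \<le> ennreal e"
proof -
  interpret L: prob_space L by fact
  have cont: "continuous_map (mtopology_of (linf T)) euclideanreal (trunc_osc (I k) (c k))" for k
    by (rule continuous_trunc_osc) (use I c in auto)
  have meas: "trunc_osc (I k) (c k) \<in> borel_measurable L" for k
    by (rule continuous_map_borel_of_metric[OF cont assms(4)])
  have bnd: "0 \<le> trunc_osc (I k) (c k) f" "trunc_osc (I k) (c k) f \<le> 1" for k f
    by (rule trunc_osc_nonneg[OF I(1) c], rule trunc_osc_le_1[OF I(1)])
  have "(\<lambda>k. integral\<^sup>L L (trunc_osc (I k) (c k))) \<longlonglongrightarrow> integral\<^sup>L L (\<lambda>_. 0)"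
    by (rule integral_dominated_convergence[where w = "\<lambda>_. 1"]) (use meas lim bnd in auto)
  then have "(\<lambda>k. integral\<^sup>L L (trunc_osc (I k) (c k))) \<longlonglongrightarrow> 0"
    by simp
  then have "\<forall>\<^sub>F k in sequentially. integral\<^sup>L L (trunc_osc (I k) (c k)) < a * e"
    using \<open>0 < a\<close> \<open>0 < e\<close> by (intro order_tendstoD(2)[of _ 0]) auto
  then obtain k where k: "integral\<^sup>L L (trunc_osc (I k) (c k)) < a * e"
    using eventually_happens'[OF sequentially_bot] by blast
  have "bounded (trunc_osc (I k) (c k) ` mspace (linf T))"
    by (rule boundedI[of _ 1]) (use bnd in auto)
  then have "(\<lambda>n. outer_expectation M (\<lambda>\<omega>. trunc_osc (I k) (c k) (Z n \<omega>)))
      \<longlonglongrightarrow> integral\<^sup>L L (trunc_osc (I k) (c k))"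
    using assms(2) cont unfolding weakly_converges_def by blast
  then have "\<forall>\<^sub>F n in sequentially. outer_expectation M (\<lambda>\<omega>. trunc_osc (I k) (c k) (Z n \<omega>)) < a * e"
    using k by (rule order_tendstoD(2))
  then have "\<forall>\<^sub>F n in sequentially.
    outer_measure_of M {\<omega> \<in> space M. a \<le> trunc_osc (I k) (c k) (Z n \<omega>)} \<le> ennreal e"
  proof eventually_elim
    case (elim n)
    then have "outer_expectation M (\<lambda>\<omega>. trunc_osc (I k) (c k) (Z n \<omega>)) / a \<le> e"
      using \<open>0 < a\<close> by (simp add: field_simps)
    moreover have "outer_measure_of M {\<omega> \<in> space M. a \<le> trunc_osc (I k) (c k) (Z n \<omega>)}
        \<le> ennreal (outer_expectation M (\<lambda>\<omega>. trunc_osc (I k) (c k) (Z n \<omega>)) / a)"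
      by (rule Markov_outer_expectation[OF assms(1) bnd \<open>0 < a\<close>])
    ultimately show ?case
      by (meson ennreal_leI order_trans)
  qed
  then show ?thesis by blast
qed

lemma trunc_osc_tendsto_0:
  fixes f :: "'c::metric_space \<Rightarrow> real"
  assumes "compact T" "T \<noteq> {}" "continuous_on T f"
  shows "(\<lambda>k. trunc_osc {(p, q). p \<in> T \<and> q \<in> T \<and> dist p q \<le> 1 / Suc k} 1 f) \<longlonglongrightarrow> 0"
proof (rule LIMSEQ_I)
  let ?I = "\<lambda>k. {(p, q). p \<in> T \<and> q \<in> T \<and> dist p q \<le> 1 / Suc k}"
  have ne: "?I k \<noteq> {}" for k
    using \<open>T \<noteq> {}\<close> by fastforce
  fix r :: real assume "0 < r"
  have "uniformly_continuous_on T f"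
    using assms compact_uniformly_continuous by blast
  then obtain d where d: "0 < d" "\<And>p q. p \<in> T \<Longrightarrow> q \<in> T \<Longrightarrow> dist q p < d \<Longrightarrow> dist (f q) (f p) < r / 2"
    unfolding uniformly_continuous_on_def using \<open>0 < r\<close> by (metis half_gt_zero)
  obtain N where N: "1 / Suc N < d"
    using \<open>0 < d\<close> nat_approx_posE by blast
  have "norm (trunc_osc (?I k) 1 f - 0) < r" if "N \<le> k" for k
  proof -
    have "1 / Suc k \<le> 1 / Suc N"
      using that by (simp add: frac_le del: of_nat_Suc)
    have "trunc_osc (?I k) 1 f \<le> r / 2"
    proof (rule trunc_osc_le[OF ne])
      fix p q assume "(p, q) \<in> ?I k"
      then have "p \<in> T" "q \<in> T" "dist p q < d"
        using N \<open>1 / Suc k \<le> 1 / Suc N\<close> by auto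
      then have "dist (f p) (f q) < r / 2"
        by (intro d(2))
      then show "min 1 (1 * \<bar>f p - f q\<bar>) \<le> r / 2"
        by (intro min.coboundedI2) (simp add: dist_real_def)
    qed
    then show ?thesis
      using trunc_osc_nonneg[OF ne, of 1 k f] \<open>0 < r\<close> by simp
  qed
  then show "\<exists>N. \<forall>k\<ge>N. norm (trunc_osc (?I k) 1 f - 0) < r" by blast
qed

lemma trunc_osc_tendsto_0_scaled:
  assumes "T \<noteq> {}" "p0 \<in> T" "\<And>p. p \<in> T \<Longrightarrow> \<bar>f p\<bar> \<le> B"
  shows "(\<lambda>k. trunc_osc (T \<times> {p0}) (1 / Suc k) f) \<longlonglongrightarrow> 0"
proof (rule real_tendsto_sandwich[where f = "\<lambda>_. 0" and h = "\<lambda>k. 2 * B * inverse (real (Suc k))"])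
  show "\<forall>\<^sub>F k in sequentially. 0 \<le> trunc_osc (T \<times> {p0}) (1 / Suc k) f"
    using assms by (intro always_eventually allI trunc_osc_nonneg) auto
  have "trunc_osc (T \<times> {p0}) (1 / Suc k) f \<le> 2 * B * inverse (real (Suc k))" for k
  proof (rule trunc_osc_le)
    fix p q assume "(p, q) \<in> T \<times> {p0}"
    then have "\<bar>f p - f q\<bar> \<le> 2 * B"
      using assms(3)[of p] assms(3)[of p0] assms(2) by auto
    then have "1 / Suc k * \<bar>f p - f q\<bar> \<le> 1 / Suc k * (2 * B)"
      by (rule mult_left_mono) simp
    then show "min 1 (1 / Suc k * \<bar>f p - f q\<bar>) \<le> 2 * B * inverse (real (Suc k))"
      by (intro min.coboundedI2) (simp add: inverse_eq_divide mult.commute)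
  qed (use assms in auto)
  then show "\<forall>\<^sub>F k in sequentially. trunc_osc (T \<times> {p0}) (1 / Suc k) f \<le> 2 * B * inverse (real (Suc k))"
    by simp
  show "(\<lambda>k. 2 * B * inverse (real (Suc k))) \<longlonglongrightarrow> 0"
    using tendsto_mult[OF tendsto_const LIMSEQ_inverse_real_of_nat] by fastforce
qed simp

lemma outer_measure_of_le_event:
  assumes "A \<subseteq> space M" "outer_measure_of M A \<le> c"
  obtains E where "E \<in> sets M" "A \<subseteq> E" "emeasure M E \<le> c"
  using outer_measure_of_attain[OF assms(1)] assms(2) by metis

text \<open>
  A weakly convergent sequence of processes with almost surely continuous limit is asymptotically
  equicontinuous and bounded in probability. The exceptional events are taken measurable, as covers
  of possibly nonmeasurable ones, so that finitely many of them can be united.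
\<close>

context
  fixes M :: "'a measure" and Z :: "nat \<Rightarrow> 'a \<Rightarrow> 'c::metric_space \<Rightarrow> real" and T :: "'c set" and L
  assumes M: "prob_space M" and T: "compact T" "T \<noteq> {}"
    and L: "prob_space L" "sets L = sets (borel_of_metric (linf T))"
    and weak: "weakly_converges M Z (linf T) L" and cont: "AE f in L. continuous_on T f"
begin

lemma weak_limit_equicontinuous:
  assumes "0 < a" "a \<le> 1" "0 < p"
  shows "\<exists>\<eta>>0. \<forall>\<^sub>F n in sequentially. \<exists>E\<in>sets M. emeasure M E \<le> ennreal p \<and>
    (\<forall>\<omega>\<in>space M - E. \<forall>x\<in>T. \<forall>x'\<in>T. dist x x' \<le> \<eta> \<longrightarrow> \<bar>Z n \<omega> x - Z n \<omega> x'\<bar> < a)"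
proof -
  let ?I = "\<lambda>k. {(x, x'). x \<in> T \<and> x' \<in> T \<and> dist x x' \<le> 1 / Suc k}"
  have "\<exists>k. \<forall>\<^sub>F n in sequentially.
      outer_measure_of M {\<omega> \<in> space M. a \<le> trunc_osc (?I k) 1 (Z n \<omega>)} \<le> ennreal p"
  proof (rule weak_limit_trunc_osc_small[OF M weak L])
    show "?I k \<noteq> {}" for k using T(2) by fastforce
    show "AE f in L. (\<lambda>k. trunc_osc (?I k) 1 f) \<longlonglongrightarrow> 0"
      using cont by eventually_elim (rule trunc_osc_tendsto_0[OF T])
  qed (use assms in auto)
  then obtain k where k: "\<forall>\<^sub>F n in sequentially.
      outer_measure_of M {\<omega> \<in> space M. a \<le> trunc_osc (?I k) 1 (Z n \<omega>)} \<le> ennreal p" ..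
  have "\<forall>\<^sub>F n in sequentially. \<exists>E\<in>sets M. emeasure M E \<le> ennreal p \<and>
    (\<forall>\<omega>\<in>space M - E. \<forall>x\<in>T. \<forall>x'\<in>T. dist x x' \<le> 1 / Suc k \<longrightarrow> \<bar>Z n \<omega> x - Z n \<omega> x'\<bar> < a)"
    using k
  proof eventually_elim
    case (elim n)
    then obtain E where E: "E \<in> sets M" "{\<omega> \<in> space M. a \<le> trunc_osc (?I k) 1 (Z n \<omega>)} \<subseteq> E" "emeasure M E \<le> ennreal p"
      by (rule outer_measure_of_le_event[rotated]) auto
    have "\<bar>Z n \<omega> x - Z n \<omega> x'\<bar> < a" if "\<omega> \<in> space M - E" "x \<in> T" "x' \<in> T" "dist x x' \<le> 1 / Suc k" for \<omega> x x'
    proof -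
      have "trunc_osc (?I k) 1 (Z n \<omega>) < a" using that(1) E(2) by (auto simp: not_le[symmetric])
      moreover have "min 1 (1 * \<bar>Z n \<omega> x - Z n \<omega> x'\<bar>) \<le> trunc_osc (?I k) 1 (Z n \<omega>)"
        by (rule le_trunc_osc) (use that in auto)
      ultimately show ?thesis using \<open>a \<le> 1\<close> by (auto simp: min_def split: if_splits)
    qed
    then show ?case using E by blast
  qed
  then show ?thesis by (intro exI[of _ "1 / Suc k"]) auto
qed

lemma weak_limit_bounded:
  assumes "x0 \<in> T" "0 < p"
  shows "\<exists>B>0. \<forall>\<^sub>F n in sequentially. \<exists>E\<in>sets M. emeasure M E \<le> ennreal p \<and>
    (\<forall>\<omega>\<in>space M - E. \<forall>x\<in>T. \<bar>Z n \<omega> x - Z n \<omega> x0\<bar> < B)"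
proof -
  have "\<exists>k. \<forall>\<^sub>F n in sequentially.
      outer_measure_of M {\<omega> \<in> space M. 1 \<le> trunc_osc (T \<times> {x0}) (1 / Suc k) (Z n \<omega>)} \<le> ennreal p"
  proof (rule weak_limit_trunc_osc_small[OF M weak L])
    show "AE f in L. (\<lambda>k. trunc_osc (T \<times> {x0}) (1 / Suc k) f) \<longlonglongrightarrow> 0"
      using cont
    proof eventually_elim
      case (elim f)
      then have "bounded (f ` T)" using T compact_continuous_image compact_imp_bounded by blast
      then obtain B where "\<And>x. x \<in> T \<Longrightarrow> \<bar>f x\<bar> \<le> B" by (auto simp: bounded_iff)
      then show ?case by (rule trunc_osc_tendsto_0_scaled[OF T(2) assms(1)])
    qed
  qed (use assms in auto)
  then obtain k where k: "\<forall>\<^sub>F n in sequentially.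
      outer_measure_of M {\<omega> \<in> space M. 1 \<le> trunc_osc (T \<times> {x0}) (1 / Suc k) (Z n \<omega>)} \<le> ennreal p" ..
  have "\<forall>\<^sub>F n in sequentially. \<exists>E\<in>sets M. emeasure M E \<le> ennreal p \<and>
    (\<forall>\<omega>\<in>space M - E. \<forall>x\<in>T. \<bar>Z n \<omega> x - Z n \<omega> x0\<bar> < Suc k)"
    using k
  proof eventually_elim
    case (elim n)
    then obtain E where E: "E \<in> sets M" "{\<omega> \<in> space M. 1 \<le> trunc_osc (T \<times> {x0}) (1 / Suc k) (Z n \<omega>)} \<subseteq> E" "emeasure M E \<le> ennreal p"
      by (rule outer_measure_of_le_event[rotated]) auto
    have "\<bar>Z n \<omega> x - Z n \<omega> x0\<bar> < Suc k" if "\<omega> \<in> space M - E" "x \<in> T" for \<omega> x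
    proof -
      have "trunc_osc (T \<times> {x0}) (1 / Suc k) (Z n \<omega>) < 1" using that(1) E(2) by (auto simp: not_le[symmetric])
      moreover have "min 1 (1 / Suc k * \<bar>Z n \<omega> x - Z n \<omega> x0\<bar>) \<le> trunc_osc (T \<times> {x0}) (1 / Suc k) (Z n \<omega>)"
        by (rule le_trunc_osc) (use that in auto)
      ultimately have "1 / Suc k * \<bar>Z n \<omega> x - Z n \<omega> x0\<bar> < 1" by linarith
      then show ?thesis by (simp add: field_simps)
    qed
    then show ?case using E by blast
  qed
  then show ?thesis by (intro exI[of _ "real (Suc k)"]) auto
qed

end

section \<open>Moving one coordinate in the unit cube\<close>

lemma mem_unit_cube: "(u :: real ^ 'd) \<in> cbox 0 1 \<longleftrightarrow> (\<forall>i. 0 \<le> u $ i \<and> u $ i \<le> 1)"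
  by (simp add: mem_box_cart)

definition with_coord :: "real ^ 'd \<Rightarrow> 'd \<Rightarrow> real \<Rightarrow> real ^ 'd" where
  "with_coord v j z = (\<chi> i. if i = j then z else v $ i)"

lemma with_coord_nth [simp]: "with_coord v j z $ i = (if i = j then z else v $ i)"
  by (simp add: with_coord_def)

lemma with_coord_unit_cube:
  "v \<in> cbox 0 1 \<Longrightarrow> 0 \<le> z \<Longrightarrow> z \<le> 1 \<Longrightarrow> with_coord v j z \<in> cbox 0 1"
  by (auto simp: mem_unit_cube)

lemma one_unit_cube: "(1 :: real ^ 'd) \<in> cbox 0 1"
  by (simp add: mem_unit_cube)

section \<open>Copulas\<close>

lemma uniform_01_greaterThanAtMost:
  fixes a b :: real
  assumes "0 \<le> a" "a \<le> b" "b \<le> 1"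
  shows "measure (uniform_measure lborel {0..1}) {a<..b} = b - a"
proof -
  have "{0..1} \<inter> {a<..b} = {a<..b}" using assms by auto
  then have "emeasure (uniform_measure lborel {0..1}) {a<..b} = ennreal (b - a)"
    using assms divide_ennreal[of "b - a" 1] by simp
  then show ?thesis using assms by (simp add: measure_def)
qed

text \<open>
  An increment in one coordinate is the mass of a subset of the strip between the two values of
  that coordinate, and the strip has the mass given by the uniform margin.
\<close>

lemma is_copula_coordinate_increment:
  fixes C :: "real ^ 'd \<Rightarrow> real"
  assumes "is_copula C" "u \<in> cbox 0 1" "u' \<in> cbox 0 1"
    and off: "\<And>i. i \<noteq> j \<Longrightarrow> u $ i = u' $ i" and le: "u' $ j \<le> u $ j"
  shows "0 \<le> C u - C u'" and "C u - C u' \<le> u $ j - u' $ j"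
proof -
  obtain \<mu> where \<mu>: "prob_space \<mu>" "sets \<mu> = sets borel"
      "distr \<mu> borel (\<lambda>w. w $ j) = uniform_measure lborel {0..1}"
      "\<And>u. u \<in> cbox 0 1 \<Longrightarrow> C u = measure \<mu> {w. w \<le> u}"
    using assms(1) unfolding is_copula_def by auto
  interpret \<mu>: prob_space \<mu> by fact
  have sp: "space \<mu> = UNIV" using sets_eq_imp_space_eq[OF \<mu>(2)] by simp
  have cl: "closed {w :: real ^ 'd. w \<le> v}" for v
    by (simp add: less_eq_vec_def closed_Collect_all closed_Collect_le continuous_on_component)
  have m: "{w. w \<le> v} \<in> sets \<mu>" for v :: "real ^ 'd"
    using cl \<mu>(2) by simp
  have "u' \<le> u"
    using off le by (metis less_eq_vec_def order_refl)
  then have sub: "{w. w \<le> u'} \<subseteq> {w. w \<le> u}"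
    by auto
  have "C u - C u' = measure \<mu> ({w. w \<le> u} - {w. w \<le> u'})"
    using \<mu>(4) assms(2,3) \<mu>.finite_measure_Diff[OF m m sub] by simp
  moreover have "measure \<mu> ({w. w \<le> u} - {w. w \<le> u'}) \<le> measure \<mu> ((\<lambda>w. w $ j) -` {u' $ j<..u $ j} \<inter> space \<mu>)"
  proof (rule \<mu>.finite_measure_mono)
    show "{w. w \<le> u} - {w. w \<le> u'} \<subseteq> (\<lambda>w. w $ j) -` {u' $ j<..u $ j} \<inter> space \<mu>"
      using off by (auto simp: sp less_eq_vec_def) (metis not_le)
    have "(\<lambda>w. w $ j) \<in> borel_measurable \<mu>"
      using \<mu>(2) by (simp cong: measurable_cong_sets)
    then show "(\<lambda>w. w $ j) -` {u' $ j<..u $ j} \<inter> space \<mu> \<in> sets \<mu>"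
      by (rule measurable_sets) simp
  qed
  moreover have "measure \<mu> ((\<lambda>w. w $ j) -` {u' $ j<..u $ j} \<inter> space \<mu>)
      = measure (distr \<mu> borel (\<lambda>w. w $ j)) {u' $ j<..u $ j}"
  proof (rule measure_distr[symmetric])
    show "(\<lambda>w. w $ j) \<in> \<mu> \<rightarrow>\<^sub>M borel"
      using \<mu>(2) by (simp cong: measurable_cong_sets)
  qed simp
  moreover have "measure (distr \<mu> borel (\<lambda>w. w $ j)) {u' $ j<..u $ j} = u $ j - u' $ j"
    unfolding \<mu>(3) using assms(2,3) le by (intro uniform_01_greaterThanAtMost) (auto simp: mem_unit_cube)
  ultimately show "0 \<le> C u - C u'" "C u - C u' \<le> u $ j - u' $ j"
    by auto
qed

lemma is_copula_margin:
  fixes C :: "real ^ 'd \<Rightarrow> real"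
  assumes "is_copula C" "0 \<le> z" "z \<le> 1"
  shows "C (with_coord 1 j z) = z"
proof -
  obtain \<mu> where \<mu>: "prob_space \<mu>" "sets \<mu> = sets borel"
      "\<And>j. distr \<mu> borel (\<lambda>w. w $ j) = uniform_measure lborel {0..1}"
      "\<And>u. u \<in> cbox 0 1 \<Longrightarrow> C u = measure \<mu> {w. w \<le> u}"
    using assms(1) unfolding is_copula_def by auto
  interpret \<mu>: prob_space \<mu> by fact
  have sp: "space \<mu> = UNIV" using sets_eq_imp_space_eq[OF \<mu>(2)] by simp
  have [measurable]: "(\<lambda>w. w $ i) \<in> borel_measurable \<mu>" for i
    using \<mu>(2) by (simp cong: measurable_cong_sets)
  have emb: "measure \<mu> {w. w $ i \<in> A} = measure (uniform_measure lborel {0..1}) A"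
    if "A \<in> sets borel" for i A
  proof -
    have "measure \<mu> ((\<lambda>w. w $ i) -` A \<inter> space \<mu>) = measure (distr \<mu> borel (\<lambda>w. w $ i)) A"
      by (rule measure_distr[symmetric]) (use that in measurable)
    then show ?thesis by (simp add: \<mu>(3) sp vimage_def)
  qed
  have one: "measure \<mu> {w. w $ i \<in> {0<..1}} = 1" for i
    using emb[of "{0<..1}" i] uniform_01_greaterThanAtMost[of 0 1] by simp
  have ae: "AE w in \<mu>. w $ i \<in> {0<..1}" for i
  proof -
    have "{w. w $ i \<in> {0<..1}} \<in> sets \<mu>"
      using measurable_sets[of "\<lambda>w. w $ i" \<mu> borel "{0<..1}"] by (simp add: sp vimage_def)
    then show ?thesis
      using \<mu>.AE_in_set_eq_1[of "{w. w $ i \<in> {0<..1}}"] one by simp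
  qed
  have "AE w in \<mu>. \<forall>i\<in>UNIV. w $ i \<in> {0<..1}"
    by (rule AE_finite_allI) (use ae in auto)
  then have ae_all: "AE w in \<mu>. \<forall>i. w $ i \<in> {0<..1}"
    by simp
  have "C (with_coord 1 j z) = measure \<mu> {w. w \<le> with_coord 1 j z}"
    by (rule \<mu>(4)) (rule with_coord_unit_cube[OF one_unit_cube assms(2,3)])
  also have "\<dots> = measure \<mu> {w. w $ j \<in> {0<..z}}"
  proof (rule measure_eq_AE)
    show "AE w in \<mu>. (w \<in> {w. w \<le> with_coord 1 j z}) = (w \<in> {w. w $ j \<in> {0<..z}})"
      using ae_all by eventually_elim (auto simp: less_eq_vec_def)
    show "{w. w $ j \<in> {0<..z}} \<in> sets \<mu>"
      using measurable_sets[of "\<lambda>w. w $ j" \<mu> borel "{0<..z}"] by (simp add: sp vimage_def)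
    have "closed {w :: real ^ 'd. w \<le> v}" for v
      by (simp add: less_eq_vec_def closed_Collect_all closed_Collect_le continuous_on_component)
    then show "{w. w \<le> with_coord 1 j z} \<in> sets \<mu>"
      using \<mu>(2) by simp
  qed
  also have "\<dots> = z"
    using emb[of "{0<..z}" j] uniform_01_greaterThanAtMost[of 0 z] assms by simp
  finally show ?thesis .
qed

section \<open>The empirical copula and rank quantiles\<close>

definition edf :: "(int \<Rightarrow> real ^ 'd) \<Rightarrow> int \<Rightarrow> int \<Rightarrow> real ^ 'd \<Rightarrow> real" where
  "edf y k l v = (1 / real_of_int (l - k + 1)) * (\<Sum>i\<in>{k..l}. of_bool (y i \<le> v))"

text \<open>
  The largest observation in coordinate \<open>j\<close> whose normalized rank is at most \<open>a\<close>, and the value 0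
  if there is none; as the observations of a \<open>pseudo_sample\<close> are positive, 0 lies below all of
  them. Evaluating the empirical d.f. at these quantiles reproduces the empirical copula exactly,
  also in the presence of ties.
\<close>

definition rank_quantile :: "(int \<Rightarrow> real ^ 'd) \<Rightarrow> int \<Rightarrow> int \<Rightarrow> 'd \<Rightarrow> real \<Rightarrow> real" where
  "rank_quantile y k l j a =
     Max (insert 0 ((\<lambda>t. y t $ j) ` {t \<in> {k..l}. ranks y k l t $ j \<le> real_of_int (l - k + 1) * a}))"

definition pseudo_sample :: "(int \<Rightarrow> real ^ 'd) \<Rightarrow> int \<Rightarrow> int \<Rightarrow> bool" where
  "pseudo_sample y k l \<longleftrightarrow> k \<le> l \<and> (\<forall>t\<in>{k..l}. \<forall>j. 0 < y t $ j \<and> y t $ j \<le> 1)"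

lemma margin_edf:
  assumes "pseudo_sample y k l"
  shows "edf y k l (with_coord 1 j z) = (1 / real_of_int (l - k + 1)) * (\<Sum>i\<in>{k..l}. of_bool (y i $ j \<le> z))"
  unfolding edf_def
  using assms by (intro arg_cong[where f = "(*) _"] sum.cong) (auto simp: less_eq_vec_def pseudo_sample_def)

lemma ranks_margin_edf:
  assumes "pseudo_sample y k l"
  shows "ranks y k l t $ j = real_of_int (l - k + 1) * edf y k l (with_coord 1 j (y t $ j))"
proof -
  have "real_of_int (l - k + 1) \<noteq> 0"
    using assms by (simp add: pseudo_sample_def del: of_int_add of_int_diff)
  then show ?thesis
    unfolding margin_edf[OF assms] ranks_def by simp
qed

lemma finite_rank_quantile:
  "finite (insert 0 ((\<lambda>t. y t $ j) ` {t \<in> {k..l}. ranks y k l t $ j \<le> real_of_int (l - k + 1) * a}))"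
  by (intro finite.insertI finite_imageI finite_subset[OF _ finite_atLeastAtMost_int[of k l]]) blast

lemma rank_quantile_bounds:
  assumes "pseudo_sample y k l"
  shows "0 \<le> rank_quantile y k l j a" "rank_quantile y k l j a \<le> 1"
proof -
  show "0 \<le> rank_quantile y k l j a"
    unfolding rank_quantile_def by (rule Max_ge[OF finite_rank_quantile]) simp
  show "rank_quantile y k l j a \<le> 1"
    unfolding rank_quantile_def using assms by (subst Max_le_iff[OF finite_rank_quantile]) (auto simp: pseudo_sample_def)
qed

lemma rank_quantile_cases:
  obtains "rank_quantile y k l j a = 0"
  | t where "t \<in> {k..l}" "ranks y k l t $ j \<le> real_of_int (l - k + 1) * a"
      "rank_quantile y k l j a = y t $ j"
proof -
  have "rank_quantile y k l j a
      \<in> insert 0 ((\<lambda>t. y t $ j) ` {t \<in> {k..l}. ranks y k l t $ j \<le> real_of_int (l - k + 1) * a})"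
    unfolding rank_quantile_def by (rule Max_in[OF finite_rank_quantile]) simp
  then show ?thesis using that by auto
qed

lemma le_rank_quantile_iff:
  assumes "pseudo_sample y k l" "t \<in> {k..l}"
  shows "y t $ j \<le> rank_quantile y k l j a \<longleftrightarrow> ranks y k l t $ j \<le> real_of_int (l - k + 1) * a"
proof
  assume le: "y t $ j \<le> rank_quantile y k l j a"
  show "ranks y k l t $ j \<le> real_of_int (l - k + 1) * a"
  proof (rule rank_quantile_cases[of y k l j a])
    assume "rank_quantile y k l j a = 0"
    moreover have "0 < y t $ j" using assms by (simp add: pseudo_sample_def)
    ultimately show ?thesis using le by simp
  next
    fix t' assume t': "ranks y k l t' $ j \<le> real_of_int (l - k + 1) * a" "rank_quantile y k l j a = y t' $ j"
    have "ranks y k l t $ j \<le> ranks y k l t' $ j"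
      unfolding ranks_def vec_lambda_beta
      by (intro sum_mono) (use le t'(2) in \<open>auto simp: of_bool_def\<close>)
    then show ?thesis using t'(1) by (rule order_trans)
  qed
next
  assume "ranks y k l t $ j \<le> real_of_int (l - k + 1) * a"
  then show "y t $ j \<le> rank_quantile y k l j a"
    unfolding rank_quantile_def using assms(2) by (intro Max_ge[OF finite_rank_quantile]) auto
qed

lemma emp_copula_eq_edf:
  assumes "pseudo_sample y k l"
  shows "emp_copula y k l u = edf y k l (\<chi> j. rank_quantile y k l j (u $ j))"
proof -
  have m: "0 < real_of_int (l - k + 1)" and kl: "\<not> k > l"
    using assms by (auto simp: pseudo_sample_def)
  have "((1 / real_of_int (l - k + 1)) *\<^sub>R ranks y k l i \<le> u) =
      (y i \<le> (\<chi> j. rank_quantile y k l j (u $ j)))" if "i \<in> {k..l}" for i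
    unfolding less_eq_vec_def using le_rank_quantile_iff[OF assms that] m
    by (simp add: field_simps del: of_int_add of_int_diff)
  then show ?thesis
    unfolding emp_copula_def edf_def using kl by simp
qed

lemma margin_edf_quantile_le:
  assumes "pseudo_sample y k l" "0 \<le> a"
  shows "edf y k l (with_coord 1 j (rank_quantile y k l j a)) \<le> a"
proof (rule rank_quantile_cases[of y k l j a])
  assume "rank_quantile y k l j a = 0"
  moreover have "(\<Sum>i\<in>{k..l}. of_bool (y i $ j \<le> 0)) = (0 :: real)"
    using assms(1) by (intro sum.neutral) (auto simp: pseudo_sample_def not_le)
  ultimately show ?thesis
    unfolding margin_edf[OF assms(1)] using assms(2) by simp
next
  fix t assume t: "ranks y k l t $ j \<le> real_of_int (l - k + 1) * a" "rank_quantile y k l j a = y t $ j"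
  have "0 < real_of_int (l - k + 1)"
    using assms(1) by (simp add: pseudo_sample_def)
  then show ?thesis
    using t unfolding ranks_margin_edf[OF assms(1)] by (simp del: of_int_add of_int_diff)
qed

text \<open>
  Ties prevent \<open>G (q a) = a\<close> from holding even up to one observation. The loss is at most the mass
  of the tie group following the quantile, and the hypothesis \<open>jump\<close> bounds such a mass: just
  below the next observation \<open>z\<close> the margin is still \<open>G (q a)\<close>, while \<open>G z\<close> exceeds \<open>a\<close>.
\<close>

lemma margin_edf_quantile_ge:
  assumes y: "pseudo_sample y k l" and a: "a \<le> 1" and "0 < \<eta>"
    and jump: "\<And>z z'. 0 \<le> z' \<Longrightarrow> z' \<le> z \<Longrightarrow> z \<le> 1 \<Longrightarrow> z - z' \<le> \<eta> \<Longrightarrow>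
      edf y k l (with_coord 1 j z) - edf y k l (with_coord 1 j z') \<le> z - z' + e"
  shows "a \<le> edf y k l (with_coord 1 j (rank_quantile y k l j a)) + e"
proof -
  define q where "q = rank_quantile y k l j a"
  have q01: "0 \<le> q" "q \<le> 1"
    using rank_quantile_bounds[OF y] by (auto simp: q_def)
  have m: "0 < real_of_int (l - k + 1)"
    using y by (simp add: pseudo_sample_def)
  define B where "B = {y t $ j |t. t \<in> {k..l} \<and> q < y t $ j}"
  have finB: "finite B" 
    by (rule finite_subset[of _ "(\<lambda>t. y t $ j) ` {k..l}"]) (auto simp: B_def)
  show ?thesis
  proof (cases "B = {}")
    case True
    then have "(\<Sum>i\<in>{k..l}. of_bool (y i $ j \<le> q)) = (\<Sum>i\<in>{k..l}. 1 :: real)"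
      by (intro sum.cong) (auto simp: B_def not_less)
    then have "edf y k l (with_coord 1 j q) = 1"
      unfolding margin_edf[OF y] using m by simp
    moreover have "0 \<le> e" using jump[of 0 0] \<open>0 < \<eta>\<close> by simp
    ultimately show ?thesis using a by (simp add: q_def)
  next
    case False
    define z where "z = Min B"
    have "z \<in> B" unfolding z_def using finB False by (rule Min_in)
    then obtain t where t: "t \<in> {k..l}" "z = y t $ j" "q < z"
      by (auto simp: B_def)
    have zmin: "z \<le> y i $ j" if "i \<in> {k..l}" "q < y i $ j" for i
      unfolding z_def using that finB by (intro Min_le) (auto simp: B_def)
    have "z \<le> 1" using y t by (auto simp: pseudo_sample_def)
    have "a < edf y k l (with_coord 1 j z)"
      using le_rank_quantile_iff[OF y t(1), of j a] t m unfolding ranks_margin_edf[OF y]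
      by (simp add: q_def del: of_int_add of_int_diff)
    \<comment> \<open>Approach \<open>z\<close> from below, where the margin has not jumped yet.\<close>
    moreover have "edf y k l (with_coord 1 j z) \<le> edf y k l (with_coord 1 j q) + e + r" if "0 < r" for r
    proof -
      define z' where "z' = max q (z - min \<eta> r)"
      have z': "q \<le> z'" "z' < z" "z - z' \<le> \<eta>" "z - z' \<le> r" "0 \<le> z'"
        using \<open>0 < r\<close> \<open>0 < \<eta>\<close> t q01 by (auto simp: z'_def)
      have "edf y k l (with_coord 1 j z') = edf y k l (with_coord 1 j q)"
        unfolding margin_edf[OF y]
        using z' zmin by (intro arg_cong[where f = "(*) _"] sum.cong) (auto, fastforce)
      then show ?thesis
        using jump[of z' z] z' \<open>z \<le> 1\<close> by simp
    qed
    then have "edf y k l (with_coord 1 j z) \<le> edf y k l (with_coord 1 j q) + e"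
      by (rule field_le_epsilon)
    ultimately show ?thesis by (simp add: q_def)
  qed
qed

text \<open>
  An observation counted by the joint increment lies in the strip between \<open>v' $ j\<close> and \<open>v $ j\<close>, so
  it is counted by the marginal increment too.
\<close>

lemma edf_coordinate_increment:
  assumes y: "pseudo_sample y k l" and off: "\<And>i. i \<noteq> j \<Longrightarrow> v $ i = v' $ i"
  shows "\<bar>edf y k l v - edf y k l v'\<bar>
    \<le> \<bar>edf y k l (with_coord 1 j (v $ j)) - edf y k l (with_coord 1 j (v' $ j))\<bar>"
proof -
  have m: "0 < real_of_int (l - k + 1)"
    using y by (simp add: pseudo_sample_def)
  have *: "0 \<le> edf y k l v - edf y k l v' \<and> edf y k l v - edf y k l v'
    \<le> edf y k l (with_coord 1 j (v $ j)) - edf y k l (with_coord 1 j (v' $ j))"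
    if off: "\<And>i. i \<noteq> j \<Longrightarrow> v $ i = v' $ i" and le: "v' $ j \<le> v $ j" for v v'
  proof -
    have sub: "x \<le> v' \<Longrightarrow> x \<le> v" for x
      using off le unfolding less_eq_vec_def by (metis order_trans)
    have "x \<le> v \<Longrightarrow> \<not> x \<le> v' \<Longrightarrow> x $ j \<le> v $ j \<and> \<not> x $ j \<le> v' $ j" for x
      using off le unfolding less_eq_vec_def by metis
    then have b: "of_bool (x \<le> v) - of_bool (x \<le> v') \<le> (of_bool (x $ j \<le> v $ j) - of_bool (x $ j \<le> v' $ j) :: real)" for x
      using le by (auto simp: of_bool_def)
    have "0 \<le> (\<Sum>i\<in>{k..l}. of_bool (y i \<le> v) - of_bool (y i \<le> v') :: real)"
      using sub by (intro sum_nonneg) (auto simp: of_bool_def)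
    moreover have "(\<Sum>i\<in>{k..l}. of_bool (y i \<le> v) - of_bool (y i \<le> v') :: real)
        \<le> (\<Sum>i\<in>{k..l}. of_bool (y i $ j \<le> v $ j) - of_bool (y i $ j \<le> v' $ j))"
      using b by (intro sum_mono)
    ultimately show ?thesis
      unfolding margin_edf[OF y] unfolding edf_def using m
      by (simp add: sum_subtractf right_diff_distrib[symmetric] divide_right_mono diff_divide_distrib[symmetric]
        del: of_int_add of_int_diff)
  qed
  show ?thesis
    using *[of v v'] *[of v' v] off by (cases "v' $ j \<le> v $ j") (auto simp: abs_if)
qed

section \<open>Partial derivatives of a copula\<close>

text \<open>
  The derivative at 0 in \<open>partial_deriv\<close> is rewritten as an ordinary derivative along
  the coordinate line, to which the mean value theorem applies.
\<close>

lemma partial_deriv_coordinate: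
  fixes C :: "real ^ 'd \<Rightarrow> real"
  assumes diff: "\<And>u. u \<in> partial_region j \<Longrightarrow> (\<lambda>r. C (u + r *\<^sub>R axis j 1)) differentiable (at 0)"
    and "v \<in> cbox 0 1" "0 < z" "z < 1"
  shows "((\<lambda>z. C (with_coord v j z)) has_real_derivative partial_deriv C j (with_coord v j z)) (at z)"
proof -
  let ?u = "with_coord v j z"
  have "?u \<in> partial_region j"
    using assms by (auto simp: partial_region_def mem_unit_cube)
  then have "((\<lambda>r. C (?u + r *\<^sub>R axis j 1)) has_real_derivative deriv (\<lambda>r. C (?u + r *\<^sub>R axis j 1)) 0) (at 0)"
    using diff by (simp add: DERIV_deriv_iff_real_differentiable)
  moreover have "?u + r *\<^sub>R axis j 1 = with_coord v j (r + z)" for r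
    by (auto simp: vec_eq_iff axis_def)
  moreover have "partial_deriv C j ?u = deriv (\<lambda>r. C (?u + r *\<^sub>R axis j 1)) 0"
    using assms by (simp add: partial_deriv_def)
  ultimately show ?thesis
    using DERIV_shift[of "\<lambda>z. C (with_coord v j z)" "partial_deriv C j ?u" 0 z] by simp
qed

lemma with_coord_self:
  "(\<And>i. i \<noteq> j \<Longrightarrow> v $ i = v' $ i) \<Longrightarrow> with_coord v j (v' $ j) = v'"
  by (auto simp: vec_eq_iff)

lemma coordinate_mean_value:
  fixes C :: "real ^ 'd \<Rightarrow> real"
  assumes diff: "\<And>u. u \<in> partial_region j \<Longrightarrow> (\<lambda>r. C (u + r *\<^sub>R axis j 1)) differentiable (at 0)"
    and v: "v \<in> cbox 0 1" and off: "\<And>i. i \<noteq> j \<Longrightarrow> v $ i = v' $ i"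
    and z: "0 < v $ j" "v $ j < 1" "0 < v' $ j" "v' $ j < 1"
  obtains z where "min (v $ j) (v' $ j) \<le> z" "z \<le> max (v $ j) (v' $ j)"
    "C v - C v' = partial_deriv C j (with_coord v j z) * (v $ j - v' $ j)"
proof -
  have C: "C v = C (with_coord v j (v $ j))" "C v' = C (with_coord v j (v' $ j))"
    using with_coord_self[of j v v] with_coord_self[of j v v'] off by auto
  have D: "((\<lambda>z. C (with_coord v j z)) has_real_derivative partial_deriv C j (with_coord v j z)) (at z)"
    if "min (v $ j) (v' $ j) \<le> z" "z \<le> max (v $ j) (v' $ j)" for z
    by (rule partial_deriv_coordinate[OF diff v]) (use that assms in auto)
  consider "v $ j = v' $ j" | "v' $ j < v $ j" | "v $ j < v' $ j" by linarith
  then show ?thesis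
  proof cases
    case 1
    then show ?thesis using that[of "v $ j"] C by simp
  next
    case 2
    then obtain z where "v' $ j < z" "z < v $ j"
      "C (with_coord v j (v $ j)) - C (with_coord v j (v' $ j)) = (v $ j - v' $ j) * partial_deriv C j (with_coord v j z)"
      using MVT2[OF 2, of "\<lambda>z. C (with_coord v j z)" "\<lambda>z. partial_deriv C j (with_coord v j z)"] D by auto
    then show ?thesis using that[of z] C 2 by (simp add: mult.commute)
  next
    case 3
    then obtain z where "v $ j < z" "z < v' $ j"
      "C (with_coord v j (v' $ j)) - C (with_coord v j (v $ j)) = (v' $ j - v $ j) * partial_deriv C j (with_coord v j z)"
      using MVT2[OF 3, of "\<lambda>z. C (with_coord v j z)" "\<lambda>z. partial_deriv C j (with_coord v j z)"] D by auto
    then show ?thesis using that[of z] C 3 by (simp add: algebra_simps)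
  qed
qed

lemma partial_deriv_copula_bounds:
  fixes C :: "real ^ 'd \<Rightarrow> real"
  assumes diff: "\<And>u. u \<in> partial_region j \<Longrightarrow> (\<lambda>r. C (u + r *\<^sub>R axis j 1)) differentiable (at 0)"
    and "is_copula C" and u: "u \<in> cbox 0 1" "0 < u $ j" "u $ j < 1"
  shows "0 \<le> partial_deriv C j u" "partial_deriv C j u \<le> 1"
proof -
  let ?f = "\<lambda>z. C (with_coord u j z)"
  have "(?f has_real_derivative partial_deriv C j (with_coord u j (u $ j))) (at (u $ j))"
    by (rule partial_deriv_coordinate[OF diff u])
  then have lim: "((\<lambda>z. (?f z - ?f (u $ j)) / (z - u $ j)) \<longlongrightarrow> partial_deriv C j u) (at (u $ j))"
    using with_coord_self[of j u u] by (simp add: has_field_derivative_iff)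
  have "\<forall>\<^sub>F z in at (u $ j). z \<in> {0<..<1}"
    by (rule eventually_at_in_open') (use u in auto)
  then have ev: "\<forall>\<^sub>F z in at (u $ j). 0 \<le> (?f z - ?f (u $ j)) / (z - u $ j)
      \<and> (?f z - ?f (u $ j)) / (z - u $ j) \<le> 1"
  proof eventually_elim
    case (elim z)
    have z: "with_coord u j z \<in> cbox 0 1" "with_coord u j (u $ j) \<in> cbox 0 1"
      using elim u(1) by (auto simp: mem_unit_cube)
    consider "z = u $ j" | "u $ j < z" | "z < u $ j" by linarith
    then show ?case
    proof cases
      case 2
      then show ?thesis
        using is_copula_coordinate_increment[OF assms(2) z, of j] by simp
    next
      case 3
      then have "0 \<le> ?f (u $ j) - ?f z" "?f (u $ j) - ?f z \<le> u $ j - z"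
        using is_copula_coordinate_increment[OF assms(2) z(2,1), of j] by simp_all
      then show ?thesis
        using 3 by (simp add: divide_le_eq zero_le_divide_iff)
    qed simp
  qed
  show "0 \<le> partial_deriv C j u"
    by (rule tendsto_lowerbound[OF lim]) (use ev in \<open>auto elim: eventually_mono\<close>)
  show "partial_deriv C j u \<le> 1"
    by (rule tendsto_upperbound[OF lim]) (use ev in \<open>auto elim: eventually_mono\<close>)
qed

section \<open>Increments of the empirical copula\<close>

text \<open>
  A fixed sample whose empirical d.f. is \<open>\<rho>\<close>-close to \<open>C\<close>, with an error that oscillates by at most
  \<open>e\<close> over moves of length \<open>\<eta>\<close> in one coordinate. For a stretch of length \<open>m\<close>, both \<open>\<rho>\<close> and \<open>e\<close> are
  of order \<open>1 / sqrt m\<close>, but the constant in \<open>e\<close> can be made as small as desired by choosing \<open>\<eta>\<close>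
  small; the bandwidths being at least of order \<open>1 / sqrt m\<close>, only errors of the size of \<open>e\<close> survive
  the division by them, so \<open>\<rho>\<close> serves to localize arguments while \<open>e\<close> enters the error bounds.
\<close>

locale sample_near_copula =
  fixes C :: "real ^ 'd \<Rightarrow> real" and y :: "int \<Rightarrow> real ^ 'd" and k l :: int and \<rho> \<eta> e :: real
  assumes copula: "is_copula C"
    and sample: "pseudo_sample y k l"
    and near: "\<And>v. v \<in> cbox 0 1 \<Longrightarrow> \<bar>edf y k l v - C v\<bar> \<le> \<rho>"
    and osc: "\<And>v v' j. v \<in> cbox 0 1 \<Longrightarrow> v' \<in> cbox 0 1 \<Longrightarrow> (\<And>i. i \<noteq> j \<Longrightarrow> v $ i = v' $ i) \<Longrightarrow>
        \<bar>v $ j - v' $ j\<bar> \<le> \<eta> \<Longrightarrow> \<bar>(edf y k l v - C v) - (edf y k l v' - C v')\<bar> \<le> e"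
    and \<eta>_pos: "0 < \<eta>"
begin

abbreviation G :: "'d \<Rightarrow> real \<Rightarrow> real" where
  "G j z \<equiv> edf y k l (with_coord 1 j z)"

abbreviation q :: "'d \<Rightarrow> real \<Rightarrow> real" where
  "q \<equiv> rank_quantile y k l"

abbreviation Q :: "real ^ 'd \<Rightarrow> real ^ 'd" where
  "Q u \<equiv> (\<chi> j. q j (u $ j))"

lemma e_nonneg: "0 \<le> e"
  using osc[OF one_unit_cube one_unit_cube] \<eta>_pos by force

lemma Q_unit_cube: "Q u \<in> cbox 0 1"
  using rank_quantile_bounds[OF sample] by (simp add: mem_unit_cube)

text \<open>
  The oscillation bound also controls the jumps of the empirical margins, hence the tie groups.
\<close>

lemma margin_quantile:
  assumes "0 \<le> a" "a \<le> 1"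
  shows "a - e \<le> G j (q j a)" "G j (q j a) \<le> a"
proof -
  have "G j z - G j z' \<le> z - z' + e"
    if "0 \<le> z'" "z' \<le> z" "z \<le> 1" "z - z' \<le> \<eta>" for z z'
  proof -
    have "\<bar>(G j z - C (with_coord 1 j z)) - (G j z' - C (with_coord 1 j z'))\<bar> \<le> e"
      by (rule osc[of _ _ j]) (use that in \<open>auto simp: mem_unit_cube\<close>)
    then show ?thesis
      using that is_copula_margin[OF copula, of z j] is_copula_margin[OF copula, of z' j] by auto
  qed
  then have "a \<le> G j (q j a) + e"
    by (rule margin_edf_quantile_ge[OF sample \<open>a \<le> 1\<close> \<eta>_pos])
  then show "a - e \<le> G j (q j a)" by simp
  show "G j (q j a) \<le> a"
    by (rule margin_edf_quantile_le[OF sample \<open>0 \<le> a\<close>])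
qed

lemma quantile_near:
  assumes "0 \<le> a" "a \<le> 1"
  shows "\<bar>q j a - a\<bar> \<le> \<rho> + e"
proof -
  have "\<bar>G j (q j a) - q j a\<bar> \<le> \<rho>"
    using near[OF with_coord_unit_cube[OF one_unit_cube rank_quantile_bounds[OF sample], of j j a]]
      is_copula_margin[OF copula rank_quantile_bounds[OF sample], of j j a] by simp
  then show ?thesis
    using margin_quantile[OF assms, of j] by linarith
qed

text \<open>
  \<open>q a\<close> itself is only \<open>\<rho> + e\<close>-close to \<open>a\<close>, but the deviations at two nearby levels almost cancel:
  they are values of the same error process at nearby points. This is why increments of the
  empirical copula are more accurate than its values.
\<close>

lemma quantile_increment:
  assumes "0 \<le> a" "a \<le> 1" "0 \<le> b" "b \<le> 1" "\<bar>a - b\<bar> + 2 * (\<rho> + e) \<le> \<eta>"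
  shows "\<bar>(q j a - q j b) - (a - b)\<bar> \<le> 2 * e"
proof -
  note qb = rank_quantile_bounds[OF sample]
  have "\<bar>q j a - q j b\<bar> \<le> \<eta>"
    using quantile_near[OF assms(1,2), of j] quantile_near[OF assms(3,4), of j] assms(5) by argo
  then have "\<bar>(G j (q j a) - C (with_coord 1 j (q j a))) - (G j (q j b) - C (with_coord 1 j (q j b)))\<bar> \<le> e"
    by (intro osc[of _ _ j]) (use qb in \<open>auto simp: mem_unit_cube\<close>)
  then show ?thesis
    using margin_quantile[OF assms(1,2), of j] margin_quantile[OF assms(3,4), of j]
      is_copula_margin[OF copula qb, of j j a] is_copula_margin[OF copula qb, of j j b]
    by linarith
qed

lemma emp_copula_increment_le:
  assumes u: "u \<in> cbox 0 1" "u' \<in> cbox 0 1" and off: "\<And>i. i \<noteq> j \<Longrightarrow> u $ i = u' $ i"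
  shows "\<bar>emp_copula y k l u - emp_copula y k l u'\<bar> \<le> \<bar>u $ j - u' $ j\<bar> + e"
proof -
  have "\<bar>edf y k l (Q u) - edf y k l (Q u')\<bar> \<le> \<bar>G j (q j (u $ j)) - G j (q j (u' $ j))\<bar>"
    using edf_coordinate_increment[OF sample, of j "Q u" "Q u'"] off by simp
  moreover have "0 \<le> u $ j" "u $ j \<le> 1" "0 \<le> u' $ j" "u' $ j \<le> 1"
    using u by (auto simp: mem_unit_cube)
  ultimately show ?thesis
    unfolding emp_copula_eq_edf[OF sample]
    using margin_quantile[of "u $ j" j] margin_quantile[of "u' $ j" j] by linarith
qed

text \<open>
  With \<open>v\<close>, \<open>v'\<close> the quantile vectors of \<open>u\<close>, \<open>u'\<close>, the increment is \<open>C v - C v'\<close> plus an oscillation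
  of the error. Only coordinate \<open>j\<close> differs, so the mean value theorem in that coordinate
  applies, wherever the remaining coordinates are, even near 0 or 1. The quantile increment in coordinate \<open>j\<close> is that of \<open>u\<close> up to \<open>2 * e\<close>.
\<close>

lemma emp_copula_increment_linear:
  assumes diff: "\<And>u. u \<in> partial_region j \<Longrightarrow> (\<lambda>r. C (u + r *\<^sub>R axis j 1)) differentiable (at 0)"
    and uc: "\<And>v. v \<in> cbox 0 1 \<Longrightarrow> \<epsilon> / 2 \<le> v $ j \<Longrightarrow> v $ j \<le> 1 - \<epsilon> / 2 \<Longrightarrow> dist v u0 < d \<Longrightarrow>
        \<bar>partial_deriv C j v - partial_deriv C j u0\<bar> \<le> \<tau>"
    and u0: "u0 \<in> cbox 0 1" "\<epsilon> \<le> u0 $ j" "u0 $ j \<le> 1 - \<epsilon>" and "0 < \<epsilon>"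
    and u: "u \<in> cbox 0 1" "u' \<in> cbox 0 1" and off: "\<And>i. i \<noteq> j \<Longrightarrow> u $ i = u' $ i"
    and close: "\<And>i. \<bar>u $ i - u0 $ i\<bar> \<le> \<theta>" "\<bar>u' $ j - u0 $ j\<bar> \<le> \<theta>"
    and small: "2 * \<theta> + 2 * (\<rho> + e) \<le> \<eta>" "\<theta> + \<rho> + e \<le> \<epsilon> / 2" "real CARD('d) * (\<theta> + \<rho> + e) < d"
  shows "\<bar>emp_copula y k l u - emp_copula y k l u' - partial_deriv C j u0 * (u $ j - u' $ j)\<bar>
    \<le> \<tau> * \<bar>u $ j - u' $ j\<bar> + 3 * e"
proof -
  have u01: "0 \<le> u $ i" "u $ i \<le> 1" "0 \<le> u' $ i" "u' $ i \<le> 1" for i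
    using u by (auto simp: mem_unit_cube)
  have near_u0: "\<bar>q i (u $ i) - u0 $ i\<bar> \<le> \<theta> + \<rho> + e" for i
    using quantile_near[of "u $ i" i] u01 close(1)[of i] by force
  have near_u0': "\<bar>q j (u' $ j) - u0 $ j\<bar> \<le> \<theta> + \<rho> + e"
    using quantile_near[of "u' $ j" j] u01 close(2) by force
  have qj: "\<epsilon> / 2 \<le> q j (u $ j)" "q j (u $ j) \<le> 1 - \<epsilon> / 2" "\<epsilon> / 2 \<le> q j (u' $ j)" "q j (u' $ j) \<le> 1 - \<epsilon> / 2"
    using near_u0[of j] near_u0' small(2) u0 by auto
  obtain z where z: "min (Q u $ j) (Q u' $ j) \<le> z" "z \<le> max (Q u $ j) (Q u' $ j)"
    "C (Q u) - C (Q u') = partial_deriv C j (with_coord (Q u) j z) * (Q u $ j - Q u' $ j)"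
    by (rule coordinate_mean_value[of j C "Q u" "Q u'"])
      (use diff Q_unit_cube off qj \<open>0 < \<epsilon>\<close> in \<open>simp_all\<close>)
  define p where "p = with_coord (Q u) j z"
  have zb: "\<epsilon> / 2 \<le> z" "z \<le> 1 - \<epsilon> / 2" "\<bar>z - u0 $ j\<bar> \<le> \<theta> + \<rho> + e"
    using z(1,2) qj near_u0[of j] near_u0' by (auto simp: min_def max_def split: if_splits)
  have p: "p \<in> cbox 0 1" "p $ j = z"
    using with_coord_unit_cube[OF Q_unit_cube] zb \<open>0 < \<epsilon>\<close> by (auto simp: p_def)
  have "dist p u0 \<le> (\<Sum>i\<in>UNIV. \<bar>(p - u0) $ i\<bar>)"
    unfolding dist_norm by (rule norm_le_l1_cart)
  also have "\<dots> \<le> (\<Sum>i\<in>(UNIV :: 'd set). \<theta> + \<rho> + e)"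
    using near_u0 zb by (intro sum_mono) (auto simp: p_def)
  finally have "dist p u0 < d" using small(3) by simp
  then have \<tau>: "\<bar>partial_deriv C j p - partial_deriv C j u0\<bar> \<le> \<tau>"
    using uc[of p] p zb by simp
  have dp: "\<bar>partial_deriv C j p\<bar> \<le> 1"
    using partial_deriv_copula_bounds[OF diff copula p(1)] zb p \<open>0 < \<epsilon>\<close> by force
  define \<Delta> where "\<Delta> = u $ j - u' $ j"
  define \<Delta>q where "\<Delta>q = q j (u $ j) - q j (u' $ j)"
  have \<Delta>q: "\<bar>\<Delta>q - \<Delta>\<bar> \<le> 2 * e"
    unfolding \<Delta>q_def \<Delta>_def
    by (rule quantile_increment) (use u01 close(1)[of j] close(2) small(1) in auto)
  have "\<bar>\<Delta>q\<bar> \<le> \<eta>"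
    using near_u0[of j] near_u0' small(1) unfolding \<Delta>q_def by (smt (verit))
  then have "\<bar>(edf y k l (Q u) - C (Q u)) - (edf y k l (Q u') - C (Q u'))\<bar> \<le> e"
    by (intro osc[of _ _ j]) (use off in \<open>auto simp: \<Delta>q_def Q_unit_cube\<close>)
  moreover have "C (Q u) - C (Q u') = partial_deriv C j p * \<Delta>q"
    using z(3) by (simp add: p_def \<Delta>q_def)
  moreover have "\<bar>partial_deriv C j p * \<Delta>q - partial_deriv C j u0 * \<Delta>\<bar> \<le> \<tau> * \<bar>\<Delta>\<bar> + 2 * e"
  proof -
    have "partial_deriv C j p * \<Delta>q - partial_deriv C j u0 * \<Delta>
      = partial_deriv C j p * (\<Delta>q - \<Delta>) + (partial_deriv C j p - partial_deriv C j u0) * \<Delta>"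
      by (simp add: algebra_simps)
    also have "\<bar>\<dots>\<bar> \<le> \<bar>partial_deriv C j p\<bar> * \<bar>\<Delta>q - \<Delta>\<bar> + \<bar>partial_deriv C j p - partial_deriv C j u0\<bar> * \<bar>\<Delta>\<bar>"
      by (metis abs_mult abs_triangle_ineq)
    also have "\<dots> \<le> 1 * (2 * e) + \<tau> * \<bar>\<Delta>\<bar>"
      using dp \<Delta>q \<tau> by (intro add_mono mult_mono) auto
    finally show ?thesis by simp
  qed
  ultimately show ?thesis
    unfolding emp_copula_eq_edf[OF sample] \<Delta>_def[symmetric] by linarith
qed

text \<open>
  The linear approximation near \<open>u0\<close> is combined with the crude Lipschitz bound far away from it,
  so that it can be integrated over a random \<open>(u, u')\<close> concentrated near \<open>u0\<close>.
\<close>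

lemma emp_copula_increment:
  assumes diff: "\<And>u. u \<in> partial_region j \<Longrightarrow> (\<lambda>r. C (u + r *\<^sub>R axis j 1)) differentiable (at 0)"
    and uc: "\<And>v. v \<in> cbox 0 1 \<Longrightarrow> \<epsilon> / 2 \<le> v $ j \<Longrightarrow> v $ j \<le> 1 - \<epsilon> / 2 \<Longrightarrow> dist v u0 < d \<Longrightarrow>
        \<bar>partial_deriv C j v - partial_deriv C j u0\<bar> \<le> \<tau>"
    and u0: "u0 \<in> cbox 0 1" "\<epsilon> \<le> u0 $ j" "u0 $ j \<le> 1 - \<epsilon>" and "0 < \<epsilon>" "0 \<le> \<tau>" "0 \<le> \<theta>"
    and u: "u \<in> cbox 0 1" "u' \<in> cbox 0 1" and off: "\<And>i. i \<noteq> j \<Longrightarrow> u $ i = u' $ i"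
    and small: "2 * \<theta> + 2 * (\<rho> + e) \<le> \<eta>" "\<theta> + \<rho> + e \<le> \<epsilon> / 2" "real CARD('d) * (\<theta> + \<rho> + e) < d"
  shows "\<bar>emp_copula y k l u - emp_copula y k l u' - partial_deriv C j u0 * (u $ j - u' $ j)\<bar>
    \<le> \<tau> * \<bar>u $ j - u' $ j\<bar> + 3 * e
      + 2 * \<bar>u $ j - u' $ j\<bar> * of_bool (\<theta>\<^sup>2 < (\<Sum>i\<in>UNIV. (u $ i - u0 $ i)\<^sup>2) + (u' $ j - u0 $ j)\<^sup>2)"
proof (cases "\<theta>\<^sup>2 < (\<Sum>i\<in>UNIV. (u $ i - u0 $ i)\<^sup>2) + (u' $ j - u0 $ j)\<^sup>2")
  case True
  have "0 < u0 $ j" "u0 $ j < 1" using u0 \<open>0 < \<epsilon>\<close> by auto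
  then have "\<bar>partial_deriv C j u0\<bar> \<le> 1"
    using partial_deriv_copula_bounds[OF diff copula u0(1)] by force
  then have "\<bar>partial_deriv C j u0 * (u $ j - u' $ j)\<bar> \<le> 1 * \<bar>u $ j - u' $ j\<bar>"
    unfolding abs_mult by (intro mult_right_mono) auto
  moreover have "0 \<le> \<tau> * \<bar>u $ j - u' $ j\<bar>" using \<open>0 \<le> \<tau>\<close> by simp
  moreover have "\<bar>emp_copula y k l u - emp_copula y k l u'\<bar> \<le> \<bar>u $ j - u' $ j\<bar> + e"
    by (rule emp_copula_increment_le[OF u off])
  ultimately have "\<bar>emp_copula y k l u - emp_copula y k l u' - partial_deriv C j u0 * (u $ j - u' $ j)\<bar>
      \<le> \<tau> * \<bar>u $ j - u' $ j\<bar> + 3 * e + 2 * \<bar>u $ j - u' $ j\<bar>"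
    using e_nonneg
      abs_triangle_ineq4[of "emp_copula y k l u - emp_copula y k l u'" "partial_deriv C j u0 * (u $ j - u' $ j)"]
    by linarith
  then show ?thesis using True by simp
next
  case False
  have sq: "(u $ i - u0 $ i)\<^sup>2 \<le> (\<Sum>i\<in>UNIV. (u $ i - u0 $ i)\<^sup>2)" for i
    by (rule member_le_sum) auto
  have "(u $ i - u0 $ i)\<^sup>2 \<le> \<theta>\<^sup>2" for i
    using False sq[of i] zero_le_power2[of "u' $ j - u0 $ j"] by linarith
  then have 1: "\<bar>u $ i - u0 $ i\<bar> \<le> \<theta>" for i
    using \<open>0 \<le> \<theta>\<close> by (simp add: abs_le_square_iff[symmetric])
  have "0 \<le> (\<Sum>i\<in>UNIV. (u $ i - u0 $ i)\<^sup>2)"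
    by (rule sum_nonneg) auto
  then have "(u' $ j - u0 $ j)\<^sup>2 \<le> \<theta>\<^sup>2"
    using False by linarith
  then have 2: "\<bar>u' $ j - u0 $ j\<bar> \<le> \<theta>"
    using \<open>0 \<le> \<theta>\<close> by (simp add: abs_le_square_iff[symmetric])
  show ?thesis
    using emp_copula_increment_linear[OF diff uc u0 \<open>0 < \<epsilon>\<close> u off 1 2 small] False by simp
qed

end

section \<open>Averaging over the smoothing variable\<close>

text \<open>
  Here \<open>\<Delta>\<close> is a random increment with mean \<open>r\<close> and \<open>S\<close> a squared distance from the point of
  linearization. Since \<open>\<Delta>\<close> need not be positive, \<open>E \<bar>\<Delta>\<bar>\<close> is bounded through the second moment,
  and \<open>2 * \<bar>\<Delta>\<bar> * of_bool _ \<le> x * \<Delta>\<^sup>2 / r + r / x * of_bool _\<close> replaces the Cauchy-Schwarz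
  inequality. All error terms other than \<open>s\<close> are then multiples of \<open>r\<close>.
\<close>

lemma expectation_linear_approximation:
  fixes Y \<Delta> S :: "'a \<Rightarrow> real"
  assumes "prob_space M" and int: "integrable M Y" "integrable M \<Delta>" "integrable M (\<lambda>\<omega>. (\<Delta> \<omega>)\<^sup>2)" "integrable M S"
    and S: "\<And>\<omega>. \<omega> \<in> space M \<Longrightarrow> 0 \<le> S \<omega>"
    and approx: "\<And>\<omega>. \<omega> \<in> space M \<Longrightarrow>
      \<bar>Y \<omega> - c * \<Delta> \<omega>\<bar> \<le> \<tau> * \<bar>\<Delta> \<omega>\<bar> + s + 2 * \<bar>\<Delta> \<omega>\<bar> * of_bool (\<theta>\<^sup>2 < S \<omega>)"
    and "integral\<^sup>L M \<Delta> = r" "0 < r" "integral\<^sup>L M (\<lambda>\<omega>. (\<Delta> \<omega>)\<^sup>2) \<le> K * r\<^sup>2" "integral\<^sup>L M S \<le> w"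
    and "0 < x" "0 < \<theta>" "0 \<le> \<tau>"
  shows "\<bar>integral\<^sup>L M Y - c * r\<bar> \<le> s + r * (\<tau> * (1 + K) / 2 + x * K + w / (x * \<theta>\<^sup>2))"
proof -
  interpret prob_space M by fact
  have pointwise: "\<bar>Y \<omega> - c * \<Delta> \<omega>\<bar>
      \<le> (\<tau> * r / 2 + s) + (\<tau> / (2 * r) + x / r) * (\<Delta> \<omega>)\<^sup>2 + r / (x * \<theta>\<^sup>2) * S \<omega>"
    if \<omega>: "\<omega> \<in> space M" for \<omega>
  proof -
    have "0 \<le> (\<bar>\<Delta> \<omega>\<bar> - r)\<^sup>2" by simp
    then have "2 * (r * \<bar>\<Delta> \<omega>\<bar>) \<le> r\<^sup>2 + (\<Delta> \<omega>)\<^sup>2"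
      by (simp add: power2_diff algebra_simps)
    then have "\<bar>\<Delta> \<omega>\<bar> \<le> r / 2 + (\<Delta> \<omega>)\<^sup>2 / (2 * r)"
      using \<open>0 < r\<close> by (simp add: field_simps power2_eq_square)
    then have 1: "\<tau> * \<bar>\<Delta> \<omega>\<bar> \<le> \<tau> * (r / 2 + (\<Delta> \<omega>)\<^sup>2 / (2 * r))"
      using \<open>0 \<le> \<tau>\<close> by (rule mult_left_mono)
    have 2: "2 * \<bar>\<Delta> \<omega>\<bar> * of_bool (\<theta>\<^sup>2 < S \<omega>) \<le> x / r * (\<Delta> \<omega>)\<^sup>2 + r / (x * \<theta>\<^sup>2) * S \<omega>"
    proof (cases "\<theta>\<^sup>2 < S \<omega>")
      case True
      have "0 \<le> (x * \<bar>\<Delta> \<omega>\<bar> - r)\<^sup>2" by simp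
      then have "2 * (x * r * \<bar>\<Delta> \<omega>\<bar>) \<le> r\<^sup>2 + x\<^sup>2 * (\<Delta> \<omega>)\<^sup>2"
        by (simp add: power2_diff power_mult_distrib algebra_simps)
      then have "2 * \<bar>\<Delta> \<omega>\<bar> \<le> x / r * (\<Delta> \<omega>)\<^sup>2 + r / x"
        using \<open>0 < r\<close> \<open>0 < x\<close> by (simp add: field_simps power2_eq_square)
      moreover have "r / x \<le> r / (x * \<theta>\<^sup>2) * S \<omega>"
        using True \<open>0 < r\<close> \<open>0 < x\<close> \<open>0 < \<theta>\<close> by (simp add: field_simps)
      ultimately show ?thesis using True by simp
    next
      case False
      then show ?thesis
        using S[OF \<omega>] \<open>0 < r\<close> \<open>0 < x\<close> by simp
    qed
    show ?thesis
      using approx[OF \<omega>] 1 2 by (simp add: algebra_simps)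
  qed
  have intd: "integrable M (\<lambda>\<omega>. Y \<omega> - c * \<Delta> \<omega>)"
    using int by simp
  have "\<bar>integral\<^sup>L M Y - c * r\<bar> = \<bar>integral\<^sup>L M (\<lambda>\<omega>. Y \<omega> - c * \<Delta> \<omega>)\<bar>"
    using int assms(8) by simp
  also have "\<dots> \<le> integral\<^sup>L M (\<lambda>\<omega>. \<bar>Y \<omega> - c * \<Delta> \<omega>\<bar>)"
    by (rule integral_abs_bound)
  also have "\<dots> \<le> integral\<^sup>L M (\<lambda>\<omega>. (\<tau> * r / 2 + s) + (\<tau> / (2 * r) + x / r) * (\<Delta> \<omega>)\<^sup>2 + r / (x * \<theta>\<^sup>2) * S \<omega>)"
    using intd int pointwise by (intro integral_mono) auto
  also have "\<dots> = (\<tau> * r / 2 + s) + (\<tau> / (2 * r) + x / r) * integral\<^sup>L M (\<lambda>\<omega>. (\<Delta> \<omega>)\<^sup>2) + r / (x * \<theta>\<^sup>2) * integral\<^sup>L M S"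
    using int by (simp add: prob_space)
  also have "\<dots> \<le> (\<tau> * r / 2 + s) + (\<tau> / (2 * r) + x / r) * (K * r\<^sup>2) + r / (x * \<theta>\<^sup>2) * w"
    using assms by (intro add_mono mult_left_mono order_refl) auto
  also have "\<dots> = s + r * (\<tau> * (1 + K) / 2 + x * K + w / (x * \<theta>\<^sup>2))"
    using \<open>0 < r\<close> by (simp add: field_simps power2_eq_square)
  finally show ?thesis .
qed

lemma emp_copula_measurable: "emp_copula x k l \<in> borel_measurable borel"
proof -
  have cl: "closed {u :: real ^ 'd. v \<le> u}" for v
    by (simp add: less_eq_vec_def closed_Collect_all closed_Collect_le continuous_on_component)
  have [measurable]: "Measurable.pred borel (\<lambda>u :: real ^ 'd. v \<le> u)" for v
    using borel_closed[OF cl] by (simp add: pred_def)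
  show ?thesis
    unfolding emp_copula_def by measurable
qed

lemma emp_copula_bounded: "\<bar>emp_copula x k l u\<bar> \<le> 1"
proof (cases "k > l")
  case False
  have "(\<Sum>i\<in>{k..l}. of_bool ((1 / real_of_int (l - k + 1)) *\<^sub>R ranks x k l i \<le> u)) \<le> (\<Sum>i\<in>{k..l}. 1 :: real)"
    by (intro sum_mono) simp
  moreover have "0 \<le> (\<Sum>i\<in>{k..l}. of_bool ((1 / real_of_int (l - k + 1)) *\<^sub>R ranks x k l i \<le> u) :: real)"
    by (intro sum_nonneg) simp
  ultimately show ?thesis
    using False by (simp add: emp_copula_def field_simps)
qed (simp add: emp_copula_def)

lemma smooth_emp_copula_eq:
  assumes "prob_space M" "smoothing_scheme M X U W" "k \<le> l" "u \<in> cbox 0 1"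
  shows "smooth_emp_copula (smoothing_law M U W) x k l u
    = (\<integral>\<omega>. emp_copula x k l (W (stretch x k l) u (U \<omega>)) \<partial>M)"
proof -
  have ne: "stretch x k l \<noteq> []"
    using assms(3) by (simp add: stretch_def)
  have meas: "(\<lambda>\<omega>. W (stretch x k l) u (U \<omega>)) \<in> borel_measurable M"
    and in01: "\<And>\<omega>. \<omega> \<in> space M \<Longrightarrow> W (stretch x k l) u (U \<omega>) \<in> cbox 0 1"
    using assms(2,4) ne unfolding smoothing_scheme_def by blast+
  have "smooth_emp_copula (smoothing_law M U W) x k l u
    = (\<integral>w. indicator (cbox 0 1) w *\<^sub>R emp_copula x k l w \<partial>distr M borel (\<lambda>\<omega>. W (stretch x k l) u (U \<omega>)))"
    using assms(3) ne by (simp add: smooth_emp_copula_def smoothing_law_def set_lebesgue_integral_def)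
  also have "\<dots> = (\<integral>\<omega>. indicator (cbox 0 1) (W (stretch x k l) u (U \<omega>)) *\<^sub>R emp_copula x k l (W (stretch x k l) u (U \<omega>)) \<partial>M)"
    by (rule integral_distr[OF meas]) (use emp_copula_measurable[of x k l] in measurable)
  also have "\<dots> = (\<integral>\<omega>. emp_copula x k l (W (stretch x k l) u (U \<omega>)) \<partial>M)"
    by (rule Bochner_Integration.integral_cong) (use in01 in auto)
  finally show ?thesis .
qed

lemma integrable_bounded_real:
  fixes f :: "'a \<Rightarrow> real"
  assumes "prob_space M" "f \<in> borel_measurable M" "\<And>\<omega>. \<omega> \<in> space M \<Longrightarrow> \<bar>f \<omega>\<bar> \<le> B"
  shows "integrable M f"
proof -
  interpret prob_space M by fact
  show ?thesis
    by (rule integrable_const_bound[of _ B]) (use assms in auto)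
qed

lemma second_moment_about:
  fixes f :: "'a \<Rightarrow> real"
  assumes "prob_space M" "integrable M f" "integrable M (\<lambda>\<omega>. (f \<omega>)\<^sup>2)"
  shows "(\<integral>\<omega>. (f \<omega> - a)\<^sup>2 \<partial>M) = prob_space.variance M f + (integral\<^sup>L M f - a)\<^sup>2"
proof -
  interpret prob_space M by fact
  have "(\<integral>\<omega>. (f \<omega> - a)\<^sup>2 \<partial>M) = (\<integral>\<omega>. (f \<omega>)\<^sup>2 - 2 * a * f \<omega> + a\<^sup>2 \<partial>M)"
    by (intro Bochner_Integration.integral_cong refl) (simp add: power2_diff)
  also have "\<dots> = integral\<^sup>L M (\<lambda>\<omega>. (f \<omega>)\<^sup>2) - 2 * a * integral\<^sup>L M f + a\<^sup>2"
    using assms by (simp add: prob_space)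
  finally show ?thesis
    using variance_eq[OF assms(2,3)] by (simp add: power2_diff)
qed

lemma smoothing_scheme_mean:
  fixes W :: "(real ^ 'd) list \<Rightarrow> real ^ 'd \<Rightarrow> real ^ 'p \<Rightarrow> real ^ 'd"
  assumes "prob_space M" "smoothing_scheme M X U W" "x \<noteq> []" "u \<in> cbox 0 1"
  shows "(\<lambda>\<omega>. W x u (U \<omega>)) \<in> borel_measurable M"
    and "\<And>\<omega>. \<omega> \<in> space M \<Longrightarrow> W x u (U \<omega>) \<in> cbox 0 1"
    and "(\<lambda>\<omega>. W x u (U \<omega>) $ j) \<in> borel_measurable M"
    and "(\<integral>\<omega>. W x u (U \<omega>) $ j \<partial>M) = u $ j"
proof -
  interpret prob_space M by fact
  show meas: "(\<lambda>\<omega>. W x u (U \<omega>)) \<in> borel_measurable M"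
    and in01: "\<And>\<omega>. \<omega> \<in> space M \<Longrightarrow> W x u (U \<omega>) \<in> cbox 0 1"
    using assms(2-4) unfolding smoothing_scheme_def by blast+
  have mean: "(\<integral>\<omega>. W x u (U \<omega>) \<partial>M) = u"
    using assms(2-4) unfolding smoothing_scheme_def by blast
  obtain B where B: "\<And>w. w \<in> cbox (0 :: real ^ 'd) 1 \<Longrightarrow> norm w \<le> B"
    using bounded_cbox[of "0 :: real ^ 'd" 1] by (auto simp: bounded_iff)
  then have "integrable M (\<lambda>\<omega>. W x u (U \<omega>))"
    using meas by (intro integrable_const_bound[of _ B] AE_I2 B in01)
  then have "(\<integral>\<omega>. W x u (U \<omega>) $ j \<partial>M) = (\<integral>\<omega>. W x u (U \<omega>) \<partial>M) $ j"
    by (rule integral_bounded_linear[OF bounded_linear_vec_nth])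
  then show "(\<integral>\<omega>. W x u (U \<omega>) $ j \<partial>M) = u $ j"
    by (simp add: mean)
  have "(\<lambda>v :: real ^ 'd. v $ j) \<in> borel_measurable borel" by simp
  then show "(\<lambda>\<omega>. W x u (U \<omega>) $ j) \<in> borel_measurable M"
    using meas by (rule measurable_compose[rotated])
qed

text \<open>
  The smoothing vectors at the two shifted points are generated from the same \<open>U\<close>, hence share
  all coordinates except \<open>j\<close>; the difference of their \<open>j\<close>th coordinates has mean \<open>r + r'\<close>, and its
  variance is at most \<open>\<kappa> / m\<close>, which is a multiple of \<open>(r + r')\<^sup>2\<close> because \<open>L / sqrt m \<le> r + r'\<close>. The
  distances of the vectors from \<open>u\<close> are small in mean square by the same variance bound.
\<close>

lemma (in sample_near_copula) smooth_increment_error: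
  assumes "prob_space M" and scheme: "smoothing_scheme M X U W"
    and emp_eq: "emp_copula x k l = emp_copula y k l"
    and var: "\<And>u i. u \<in> cbox 0 1 \<Longrightarrow>
      prob_space.variance M (\<lambda>\<omega>. W (stretch x k l) u (U \<omega>) $ i) \<le> \<kappa> * (u $ i) * (1 - u $ i) / m"
    and m: "0 < m" and \<kappa>: "0 < \<kappa>" and L: "0 < L"
    and diff: "\<And>u. u \<in> partial_region j \<Longrightarrow> (\<lambda>r. C (u + r *\<^sub>R axis j 1)) differentiable (at 0)"
    and uc: "\<And>v. v \<in> cbox 0 1 \<Longrightarrow> \<epsilon> / 2 \<le> v $ j \<Longrightarrow> v $ j \<le> 1 - \<epsilon> / 2 \<Longrightarrow> dist v u < d \<Longrightarrow>
        \<bar>partial_deriv C j v - partial_deriv C j u\<bar> \<le> \<tau>"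
    and u: "u \<in> cbox 0 1" "\<epsilon> \<le> u $ j" "u $ j \<le> 1 - \<epsilon>" and "0 < \<epsilon>" "0 \<le> \<tau>" "0 < \<theta>" "0 < z"
    and small: "2 * \<theta> + 2 * (\<rho> + e) \<le> \<eta>" "\<theta> + \<rho> + e \<le> \<epsilon> / 2" "real CARD('d) * (\<theta> + \<rho> + e) < d"
    and r: "0 \<le> r" "0 \<le> r'" "r \<le> \<beta>" "r' \<le> \<beta>" "\<beta> \<le> \<epsilon>" "L / sqrt m \<le> r + r'"
  shows "\<bar>smooth_increment (smoothing_law M U W) r r' x j k l u / (r + r') - partial_deriv C j u\<bar>
    \<le> 3 * e * sqrt m / L + \<tau> * (2 + \<kappa> / L\<^sup>2) / 2 + z * (1 + \<kappa> / L\<^sup>2)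
      + (real CARD('d) + 1) * (\<kappa> / m + \<beta>\<^sup>2) / (z * \<theta>\<^sup>2)"
proof -
  interpret prob_space M by fact
  have kl: "k \<le> l" using sample by (simp add: pseudo_sample_def)
  define ds where "ds = stretch x k l"
  have ne: "ds \<noteq> []" using kl by (simp add: ds_def stretch_def)
  have u01: "0 \<le> u $ i" "u $ i \<le> 1" for i using u(1) by (auto simp: mem_unit_cube)
  have "0 < L / sqrt m" using m L by simp
  then have R: "0 < r + r'" using r(6) by linarith
  define up um where "up = with_coord u j (u $ j + r)" and "um = with_coord u j (u $ j - r')"
  have up: "inf (u + r *\<^sub>R axis j 1) 1 = up" and um: "sup (u - r' *\<^sub>R axis j 1) 0 = um"
    using u01 r u by (auto simp: up_def um_def vec_eq_iff inf_vec_def sup_vec_def axis_def inf_real_def sup_real_def)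
  have up01: "up \<in> cbox 0 1" and um01: "um \<in> cbox 0 1"
    unfolding up_def um_def using u01 u r by (auto intro!: with_coord_unit_cube)
  define wp wm where "wp \<omega> = W ds up (U \<omega>)" and "wm \<omega> = W ds um (U \<omega>)" for \<omega>
  note wp = smoothing_scheme_mean[OF assms(1) scheme ne up01, folded wp_def]
  note wm = smoothing_scheme_mean[OF assms(1) scheme ne um01, folded wm_def]
  note [measurable] = wp(1,3) wm(1,3) emp_copula_measurable
  have wp01: "0 \<le> wp \<omega> $ i" "wp \<omega> $ i \<le> 1" and wm01: "0 \<le> wm \<omega> $ i" "wm \<omega> $ i \<le> 1"
    if "\<omega> \<in> space M" for \<omega> i
    using wp(2)[OF that] wm(2)[OF that] by (auto simp: mem_unit_cube)
  have off: "wp \<omega> $ i = wm \<omega> $ i" if "\<omega> \<in> space M" "i \<noteq> j" for \<omega> i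
  proof -
    have "U \<omega> \<in> cbox 0 1" using scheme that unfolding smoothing_scheme_def by blast
    moreover have "up $ i = um $ i" using that by (simp add: up_def um_def)
    ultimately show ?thesis
      using scheme ne up01 um01 unfolding smoothing_scheme_def wp_def wm_def by blast
  qed
  have var_le: "variance (\<lambda>\<omega>. W ds v (U \<omega>) $ i) \<le> \<kappa> / (4 * m)" if "v \<in> cbox 0 1" for v i
  proof -
    have "0 \<le> (v $ i - 1 / 2)\<^sup>2" by simp
    then have "v $ i * (1 - v $ i) \<le> 1 / 4"
      by (simp add: power2_eq_square algebra_simps)
    then have "\<kappa> * (v $ i * (1 - v $ i)) / m \<le> \<kappa> * (1 / 4) / m"
      using \<kappa> m by (intro divide_right_mono mult_left_mono) auto
    then show ?thesis
      using var[OF that, of i] by (simp add: ds_def mult.assoc)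
  qed
  have int_sq: "integrable M (\<lambda>\<omega>. (f \<omega> - a)\<^sup>2)"
    if [measurable]: "f \<in> borel_measurable M" and "\<And>\<omega>. \<omega> \<in> space M \<Longrightarrow> 0 \<le> f \<omega> \<and> f \<omega> \<le> 1"
    for f :: "_ \<Rightarrow> real" and a
  proof (rule integrable_bounded_real[OF assms(1), of _ "(1 + \<bar>a\<bar>)\<^sup>2"])
    fix \<omega> assume "\<omega> \<in> space M"
    then have "\<bar>f \<omega> - a\<bar> \<le> \<bar>1 + \<bar>a\<bar>\<bar>" using that(2)[of \<omega>] by linarith
    then show "\<bar>(f \<omega> - a)\<^sup>2\<bar> \<le> (1 + \<bar>a\<bar>)\<^sup>2" using abs_le_square_iff[of "f \<omega> - a" "1 + \<bar>a\<bar>"] by simp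
  qed measurable
  have int_p: "integrable M (\<lambda>\<omega>. wp \<omega> $ i)" and int_m: "integrable M (\<lambda>\<omega>. wm \<omega> $ i)" for i
    using wp01 wm01 by (auto intro!: integrable_bounded_real[OF assms(1), of _ 1] simp: abs_of_nonneg)
  have sq_p: "(\<integral>\<omega>. (wp \<omega> $ i - a)\<^sup>2 \<partial>M) \<le> \<kappa> / (4 * m) + (up $ i - a)\<^sup>2"
    and sq_m: "(\<integral>\<omega>. (wm \<omega> $ i - a)\<^sup>2 \<partial>M) \<le> \<kappa> / (4 * m) + (um $ i - a)\<^sup>2" for i a
    using second_moment_about[OF assms(1) int_p[of i], of a] int_sq[of "\<lambda>\<omega>. wp \<omega> $ i" 0]
      second_moment_about[OF assms(1) int_m[of i], of a] int_sq[of "\<lambda>\<omega>. wm \<omega> $ i" 0]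
      wp01 wm01 var_le[OF up01, of i] var_le[OF um01, of i] wp(4)[of i] wm(4)[of i]
    by (simp_all add: wp_def[symmetric] wm_def[symmetric])
  define \<Delta> where "\<Delta> \<omega> = wp \<omega> $ j - wm \<omega> $ j" for \<omega>
  define S where "S \<omega> = (\<Sum>i\<in>UNIV. (wp \<omega> $ i - u $ i)\<^sup>2) + (wm \<omega> $ j - u $ j)\<^sup>2" for \<omega>
  have [measurable]: "\<Delta> \<in> borel_measurable M" unfolding \<Delta>_def by measurable
  have E\<Delta>: "integral\<^sup>L M \<Delta> = r + r'"
    using int_p int_m wp(4)[of j] wm(4)[of j] by (simp add: \<Delta>_def[abs_def] up_def um_def)
  have int\<Delta>: "integrable M \<Delta>"
    using int_p int_m by (simp add: \<Delta>_def[abs_def])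
  have int\<Delta>2: "integrable M (\<lambda>\<omega>. (\<Delta> \<omega>)\<^sup>2)"
  proof (rule integrable_bounded_real[OF assms(1), of _ 1])
    fix \<omega> assume "\<omega> \<in> space M"
    then have "\<bar>\<Delta> \<omega>\<bar> \<le> 1" using wp01[of \<omega> j] wm01[of \<omega> j] by (simp add: \<Delta>_def abs_le_iff)
    then show "\<bar>(\<Delta> \<omega>)\<^sup>2\<bar> \<le> 1" by (simp add: abs_square_le_1)
  qed measurable
  have E\<Delta>2: "(\<integral>\<omega>. (\<Delta> \<omega>)\<^sup>2 \<partial>M) \<le> (1 + \<kappa> / L\<^sup>2) * (r + r')\<^sup>2"
  proof -
    have "variance \<Delta> \<le> (\<integral>\<omega>. 2 * (wp \<omega> $ j - up $ j)\<^sup>2 + 2 * (wm \<omega> $ j - um $ j)\<^sup>2 \<partial>M)"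
      unfolding E\<Delta>
    proof (rule integral_mono)
      have "integrable M (\<lambda>\<omega>. (\<Delta> \<omega>)\<^sup>2 - 2 * (r + r') * \<Delta> \<omega> + (r + r')\<^sup>2)"
        using int\<Delta> int\<Delta>2 by simp
      then show "integrable M (\<lambda>\<omega>. (\<Delta> \<omega> - (r + r'))\<^sup>2)"
        by (rule Bochner_Integration.integrable_cong[THEN iffD1, rotated -1])
          (auto simp: power2_diff)
      show "integrable M (\<lambda>\<omega>. 2 * (wp \<omega> $ j - up $ j)\<^sup>2 + 2 * (wm \<omega> $ j - um $ j)\<^sup>2)"
        using int_sq[of "\<lambda>\<omega>. wp \<omega> $ j"] int_sq[of "\<lambda>\<omega>. wm \<omega> $ j"] wp01 wm01 by simp
      fix \<omega>
      have "(a - b)\<^sup>2 \<le> 2 * a\<^sup>2 + 2 * b\<^sup>2" for a b :: real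
        using zero_le_power2[of "a + b"] by (simp add: power2_sum power2_diff)
      moreover have "\<Delta> \<omega> - (r + r') = (wp \<omega> $ j - up $ j) - (wm \<omega> $ j - um $ j)"
        by (simp add: \<Delta>_def up_def um_def)
      ultimately show "(\<Delta> \<omega> - (r + r'))\<^sup>2 \<le> 2 * (wp \<omega> $ j - up $ j)\<^sup>2 + 2 * (wm \<omega> $ j - um $ j)\<^sup>2"
        by simp
    qed
    also have "\<dots> \<le> 2 * (\<kappa> / (4 * m)) + 2 * (\<kappa> / (4 * m))"
      using int_sq[of "\<lambda>\<omega>. wp \<omega> $ j"] int_sq[of "\<lambda>\<omega>. wm \<omega> $ j"] wp01 wm01
        sq_p[of j "up $ j"] sq_m[of j "um $ j"] by simp
    also have "\<dots> = \<kappa> / m" by simp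
    also have "\<dots> \<le> \<kappa> / L\<^sup>2 * (r + r')\<^sup>2"
    proof -
      have "(L / sqrt m)\<^sup>2 \<le> (r + r')\<^sup>2"
        using r(6) \<open>0 < L / sqrt m\<close> by (intro power_mono) auto
      then have "\<kappa> / L\<^sup>2 * (L\<^sup>2 / m) \<le> \<kappa> / L\<^sup>2 * (r + r')\<^sup>2"
        using m \<kappa> by (intro mult_left_mono) (auto simp: power_divide)
      then show ?thesis using L by simp
    qed
    finally show ?thesis
      using second_moment_about[OF assms(1) int\<Delta> int\<Delta>2, of 0] E\<Delta> by (simp add: algebra_simps)
  qed
  have intS: "integrable M S"
    unfolding S_def[abs_def]
    using int_sq[of "\<lambda>\<omega>. wp \<omega> $ i" for i] int_sq[of "\<lambda>\<omega>. wm \<omega> $ j"] wp01 wm01 by simp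
  have ES: "integral\<^sup>L M S \<le> (real CARD('d) + 1) * (\<kappa> / m + \<beta>\<^sup>2)"
  proof -
    have b: "\<kappa> / (4 * m) + a \<le> \<kappa> / m + \<beta>\<^sup>2" if "a \<le> \<beta>\<^sup>2" for a
    proof -
      have "\<kappa> / (4 * m) \<le> \<kappa> / m"
        using \<kappa> m by (intro divide_left_mono) auto
      then show ?thesis using that by linarith
    qed
    have r2: "r\<^sup>2 \<le> \<beta>\<^sup>2" "r'\<^sup>2 \<le> \<beta>\<^sup>2" using r by (auto intro!: power_mono)
    have 1: "(\<integral>\<omega>. (wp \<omega> $ i - u $ i)\<^sup>2 \<partial>M) \<le> \<kappa> / m + \<beta>\<^sup>2" for i
      by (rule order_trans[OF sq_p b]) (use r2 in \<open>auto simp: up_def\<close>)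
    have 2: "(\<integral>\<omega>. (wm \<omega> $ j - u $ j)\<^sup>2 \<partial>M) \<le> \<kappa> / m + \<beta>\<^sup>2"
      by (rule order_trans[OF sq_m b]) (use r2 in \<open>auto simp: um_def\<close>)
    have "integral\<^sup>L M S = (\<Sum>i\<in>UNIV. \<integral>\<omega>. (wp \<omega> $ i - u $ i)\<^sup>2 \<partial>M) + (\<integral>\<omega>. (wm \<omega> $ j - u $ j)\<^sup>2 \<partial>M)"
      unfolding S_def[abs_def]
      using int_sq[of "\<lambda>\<omega>. wp \<omega> $ i" for i] int_sq[of "\<lambda>\<omega>. wm \<omega> $ j"] wp01 wm01
      by (subst Bochner_Integration.integral_add) (auto intro!: Bochner_Integration.integral_sum)
    also have "\<dots> \<le> (\<Sum>i\<in>(UNIV :: 'd set). \<kappa> / m + \<beta>\<^sup>2) + (\<kappa> / m + \<beta>\<^sup>2)"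
      using 1 2 by (intro add_mono sum_mono)
    finally show ?thesis by (simp add: algebra_simps)
  qed
  define Y where "Y \<omega> = emp_copula y k l (wp \<omega>) - emp_copula y k l (wm \<omega>)" for \<omega>
  have int_emp: "integrable M (\<lambda>\<omega>. emp_copula y k l (wp \<omega>))" "integrable M (\<lambda>\<omega>. emp_copula y k l (wm \<omega>))"
    by (rule integrable_bounded_real[OF assms(1), of _ 1]; use emp_copula_bounded in auto)+
  have EY: "integral\<^sup>L M Y = smooth_increment (smoothing_law M U W) r r' x j k l u"
    unfolding smooth_increment_def up um Y_def[abs_def]
    using int_emp smooth_emp_copula_eq[OF assms(1) scheme kl up01, of x] smooth_emp_copula_eq[OF assms(1) scheme kl um01, of x]
    by (simp add: emp_eq wp_def wm_def ds_def)
  have "\<bar>integral\<^sup>L M Y - partial_deriv C j u * (r + r')\<bar>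
    \<le> 3 * e + (r + r') * (\<tau> * (1 + (1 + \<kappa> / L\<^sup>2)) / 2 + z * (1 + \<kappa> / L\<^sup>2)
        + (real CARD('d) + 1) * (\<kappa> / m + \<beta>\<^sup>2) / (z * \<theta>\<^sup>2))"
  proof (rule expectation_linear_approximation[OF assms(1) _ int\<Delta> int\<Delta>2 intS _ _ E\<Delta> R E\<Delta>2 ES \<open>0 < z\<close> \<open>0 < \<theta>\<close> \<open>0 \<le> \<tau>\<close>])
    show "integrable M Y" unfolding Y_def[abs_def] using int_emp by simp
    fix \<omega> assume \<omega>: "\<omega> \<in> space M"
    show "0 \<le> S \<omega>" by (simp add: S_def sum_nonneg)
    show "\<bar>Y \<omega> - partial_deriv C j u * \<Delta> \<omega>\<bar> \<le> \<tau> * \<bar>\<Delta> \<omega>\<bar> + 3 * e + 2 * \<bar>\<Delta> \<omega>\<bar> * of_bool (\<theta>\<^sup>2 < S \<omega>)"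
      unfolding Y_def \<Delta>_def S_def
      by (rule emp_copula_increment[OF diff uc u \<open>0 < \<epsilon>\<close> \<open>0 \<le> \<tau>\<close> _ wp(2)[OF \<omega>] wm(2)[OF \<omega>] off[OF \<omega>] small])
        (use \<open>0 < \<theta>\<close> in auto)
  qed
  moreover have "\<bar>A / R - c\<bar> \<le> b / R + B" if "\<bar>A - c * R\<bar> \<le> b + R * B" "0 < R" for A c R b B :: real
  proof -
    have "A / R - c = (A - c * R) / R"
      using \<open>0 < R\<close> by (simp add: field_simps)
    then have "\<bar>A / R - c\<bar> = \<bar>A - c * R\<bar> / R"
      using \<open>0 < R\<close> by simp
    also have "\<dots> \<le> (b + R * B) / R"
      using that by (intro divide_right_mono) auto
    finally show ?thesis using \<open>0 < R\<close> by (simp add: add_divide_distrib)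
  qed
  ultimately have "\<bar>integral\<^sup>L M Y / (r + r') - partial_deriv C j u\<bar>
    \<le> 3 * e / (r + r') + (\<tau> * (1 + (1 + \<kappa> / L\<^sup>2)) / 2 + z * (1 + \<kappa> / L\<^sup>2)
        + (real CARD('d) + 1) * (\<kappa> / m + \<beta>\<^sup>2) / (z * \<theta>\<^sup>2))"
    using R by blast
  moreover have "3 * e / (r + r') \<le> 3 * e / (L / sqrt m)"
    by (rule frac_le[OF _ order_refl \<open>0 < L / sqrt m\<close> r(6)]) (use e_nonneg in simp)
  ultimately show ?thesis
    using EY by simp
qed

section \<open>The probability integral transform\<close>

text \<open>
  For \<open>c < 1\<close> the sublevel set of a continuous d.f. is closed and bounded above, so it is empty or
  contains its supremum, where the d.f. is at most \<open>c\<close>.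
\<close>

lemma prob_cdf_transform_le:
  assumes "prob_space M" and Z [measurable]: "Z \<in> borel_measurable M"
    and cont: "continuous_on UNIV (cdf (distr M borel Z))" and "0 \<le> c"
  shows "measure M {\<omega> \<in> space M. cdf (distr M borel Z) (Z \<omega>) \<le> c} \<le> c"
proof -
  interpret prob_space M by fact
  interpret D: real_distribution "distr M borel Z"
    by (rule real_distribution_distr) simp
  let ?F = "cdf (distr M borel Z)"
  show ?thesis
  proof (cases "c < 1")
    case False
    then show ?thesis using prob_le_1[of "{\<omega> \<in> space M. ?F (Z \<omega>) \<le> c}"] by linarith
  next
    case True
    let ?S = "{x. ?F x \<le> c}"
    have "closed ?S"
      using cont by (intro closed_Collect_le continuous_on_const)
    show ?thesis
    proof (cases "?S = {}")
      case True
      then show ?thesis using \<open>0 \<le> c\<close> by (auto simp: measure_empty)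
    next
      case False
      have "\<forall>\<^sub>F x in at_top. c < ?F x"
        using D.cdf_lim_at_top_prob True by (rule order_tendstoD(1))
      then obtain N where N: "\<And>x. N \<le> x \<Longrightarrow> c < ?F x"
        by (auto simp: eventually_at_top_linorder)
      have bdd: "bdd_above ?S"
        by (rule bdd_aboveI[of _ N]) (metis N linear mem_Collect_eq not_le)
      have "Sup ?S \<in> ?S"
        by (rule closed_contains_Sup[OF False bdd \<open>closed ?S\<close>])
      have "measure M {\<omega> \<in> space M. ?F (Z \<omega>) \<le> c} \<le> measure M (Z -` {..Sup ?S} \<inter> space M)"
        by (rule finite_measure_mono) (use cSup_upper[OF _ bdd] in auto)
      also have "\<dots> = ?F (Sup ?S)"
        unfolding cdf_def by (rule measure_distr[symmetric]) auto
      also have "\<dots> \<le> c" using \<open>Sup ?S \<in> ?S\<close> by simp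
      finally show ?thesis .
    qed
  qed
qed

text \<open>
  The second part says that almost no realization lies in a flat piece of the d.f. beyond \<open>r\<close>:
  the event \<open>F Z \<le> F r\<close> contains \<open>Z \<le> r\<close> and has no larger probability.
\<close>

lemma AE_cdf_transform:
  assumes "prob_space M" and Z [measurable]: "Z \<in> borel_measurable M"
    and cont: "continuous_on UNIV (cdf (distr M borel Z))"
  shows "AE \<omega> in M. 0 < cdf (distr M borel Z) (Z \<omega>)"
    and "AE \<omega> in M. cdf (distr M borel Z) (Z \<omega>) \<le> cdf (distr M borel Z) r \<longrightarrow> Z \<omega> \<le> r"
proof -
  interpret prob_space M by fact
  interpret D: real_distribution "distr M borel Z"
    by (rule real_distribution_distr) simp
  let ?F = "cdf (distr M borel Z)"
  have [measurable]: "?F \<in> borel_measurable borel"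
    using cont by (rule borel_measurable_continuous_onI)
  have "measure M {\<omega> \<in> space M. ?F (Z \<omega>) \<le> 0} \<le> 0"
    by (rule prob_cdf_transform_le[OF assms]) simp
  then have "measure M {\<omega> \<in> space M. \<not> 0 < ?F (Z \<omega>)} = 0"
    by (simp add: not_less measure_le_0_iff)
  then show "AE \<omega> in M. 0 < ?F (Z \<omega>)"
    by (subst AE_iff_measurable[OF _ refl]) (auto simp: emeasure_eq_measure)
  have "measure M ({\<omega> \<in> space M. ?F (Z \<omega>) \<le> ?F r} - (Z -` {..r} \<inter> space M))
      = measure M {\<omega> \<in> space M. ?F (Z \<omega>) \<le> ?F r} - measure M (Z -` {..r} \<inter> space M)"
    by (rule finite_measure_Diff) (auto intro: D.cdf_nondecreasing)
  also have "measure M (Z -` {..r} \<inter> space M) = ?F r"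
    unfolding cdf_def by (rule measure_distr[symmetric]) auto
  also have "measure M {\<omega> \<in> space M. ?F (Z \<omega>) \<le> ?F r} - ?F r \<le> 0"
    using prob_cdf_transform_le[OF assms, of "?F r"] D.cdf_nonneg by simp
  finally have "measure M ({\<omega> \<in> space M. ?F (Z \<omega>) \<le> ?F r} - (Z -` {..r} \<inter> space M)) = 0"
    by (simp add: measure_le_0_iff)
  moreover have "{\<omega> \<in> space M. \<not> (?F (Z \<omega>) \<le> ?F r \<longrightarrow> Z \<omega> \<le> r)}
      = {\<omega> \<in> space M. ?F (Z \<omega>) \<le> ?F r} - (Z -` {..r} \<inter> space M)"
    by auto
  ultimately show "AE \<omega> in M. ?F (Z \<omega>) \<le> ?F r \<longrightarrow> Z \<omega> \<le> r"
    by (subst AE_iff_measurable[OF _ refl]) (auto simp: emeasure_eq_measure)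
qed

section \<open>Pseudo-observations\<close>

lemma strictly_stationary_margin_df:
  fixes X :: "int \<Rightarrow> 'a \<Rightarrow> real ^ 'd"
  assumes "strictly_stationary M X" and X [measurable]: "\<And>i. X i \<in> borel_measurable M"
  shows "margin_df M (X i) j = margin_df M (X 0) j"
proof -
  let ?P = "PiM (UNIV :: int set) (\<lambda>_. borel :: (real ^ 'd) measure)"
  have eq: "distr M ?P (\<lambda>\<omega> a. X (a + i) \<omega>) = distr M ?P (\<lambda>\<omega> a. X a \<omega>)"
    using assms(1) by (simp add: strictly_stationary_def)
  have [measurable]: "(\<lambda>v :: real ^ 'd. v $ j) \<in> borel_measurable borel" by simp
  have m: "(\<lambda>\<omega> a. X (a + r) \<omega>) \<in> M \<rightarrow>\<^sub>M ?P" for r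
    by (rule measurable_PiM_single') auto
  have c: "(\<lambda>x. x 0 $ j) \<in> ?P \<rightarrow>\<^sub>M borel" by measurable
  have "distr M borel (\<lambda>\<omega>. X r \<omega> $ j) = distr (distr M ?P (\<lambda>\<omega> a. X (a + r) \<omega>)) borel (\<lambda>x. x 0 $ j)" for r
    by (subst distr_distr[OF c m]) (simp add: o_def)
  from this[of i] this[of 0] show ?thesis
    using eq by (simp add: margin_df_def)
qed

text \<open>
  Flat pieces of a margin could identify distinct observations. But two observations ordered
  strictly are separated by a rational, and outside countably many null sets, one for each
  rational, observation and coordinate, their transforms do not coincide. Thus ranks can be computed from the pseudo-observations.
\<close>

lemma AE_pseudo_obs:
  fixes X :: "int \<Rightarrow> 'a \<Rightarrow> real ^ 'd"
  assumes "prob_space M" and X [measurable]: "\<And>i. X i \<in> borel_measurable M"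
    and stat: "strictly_stationary M X"
    and cont: "\<And>i j. continuous_on UNIV (margin_df M (X i) j)"
  shows "AE \<omega> in M. \<forall>t i j. (X t \<omega> $ j \<le> X i \<omega> $ j \<longleftrightarrow> pseudo_obs M X t \<omega> $ j \<le> pseudo_obs M X i \<omega> $ j)
      \<and> 0 < pseudo_obs M X t \<omega> $ j \<and> pseudo_obs M X t \<omega> $ j \<le> 1"
proof -
  interpret prob_space M by fact
  define F where "F j = margin_df M (X 0) j" for j
  have F: "margin_df M (X i) j = F j" for i j
    unfolding F_def by (rule strictly_stationary_margin_df[OF stat X])
  have cm [measurable]: "(\<lambda>\<omega>. X i \<omega> $ j) \<in> borel_measurable M" for i j
    using measurable_compose[OF X, of "\<lambda>v. v $ j" borel] by simp
  have Fd: "F j = cdf (distr M borel (\<lambda>\<omega>. X i \<omega> $ j))" for i j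
    using F[of i j] by (simp add: margin_df_def)
  have rd: "real_distribution (distr M borel (\<lambda>\<omega>. X i \<omega> $ j))" for i j
    by (rule real_distribution_distr) simp
  have mono: "F j a \<le> F j b" if "a \<le> b" for j a b
    unfolding Fd[of j 0] using that
    by (intro finite_borel_measure.cdf_nondecreasing real_distribution.finite_borel_measure_M rd)
  have le1: "F j a \<le> 1" for j a
    unfolding Fd[of j 0] by (intro real_distribution.cdf_bounded_prob rd)
  have contF: "continuous_on UNIV (cdf (distr M borel (\<lambda>\<omega>. X i \<omega> $ j)))" for i j
    using cont[of i j] by (simp add: margin_df_def)
  have 1: "AE \<omega> in M. 0 < F j (X i \<omega> $ j)" for i j
    using AE_cdf_transform(1)[OF assms(1) cm contF, of i j] by (simp add: Fd[of j i])
  have 2: "AE \<omega> in M. F j (X i \<omega> $ j) \<le> F j r \<longrightarrow> X i \<omega> $ j \<le> r" for i j r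
    using AE_cdf_transform(2)[OF assms(1) cm contF, of i j r] by (simp add: Fd[of j i])
  have "AE \<omega> in M. \<forall>j\<in>UNIV. \<forall>i (r :: rat). 0 < F j (X i \<omega> $ j)
      \<and> (F j (X i \<omega> $ j) \<le> F j (of_rat r) \<longrightarrow> X i \<omega> $ j \<le> of_rat r)"
    by (rule AE_finite_allI) (use 1 2 in \<open>auto simp: AE_all_countable\<close>)
  then show ?thesis
  proof eventually_elim
    case (elim \<omega>)
    have "X t \<omega> $ j \<le> X i \<omega> $ j" if "F j (X t \<omega> $ j) \<le> F j (X i \<omega> $ j)" for t i j
    proof (rule ccontr)
      assume "\<not> X t \<omega> $ j \<le> X i \<omega> $ j"
      then obtain r where r: "X i \<omega> $ j < of_rat r" "of_rat r < X t \<omega> $ j"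
        using of_rat_dense by (metis not_le)
      have "F j (X t \<omega> $ j) \<le> F j (of_rat r)"
        using that mono[of "X i \<omega> $ j" "of_rat r" j] r by simp
      then have "X t \<omega> $ j \<le> of_rat r" using elim by blast
      then show False using r by simp
    qed
    then show ?case
      using elim mono le1 by (auto simp: pseudo_obs_def F)
  qed
qed

lemma emp_copula_order_invariant:
  assumes "\<And>t i j. x t $ j \<le> x i $ j \<longleftrightarrow> y t $ j \<le> y i $ j"
  shows "emp_copula x k l = emp_copula y k l"
proof -
  have "ranks x k l i = ranks y k l i" for i
    unfolding ranks_def by (simp add: assms)
  then show ?thesis by (simp add: emp_copula_def fun_eq_iff)
qed

section \<open>Uniform consistency\<close>

lemma edf_eq_seq_emp_process:
  fixes s t :: real
  assumes "0 < n" "0 \<le> s" "k = \<lfloor>real n * s\<rfloor> + 1" "l = \<lfloor>real n * t\<rfloor>" "k \<le> l"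
  shows "edf (\<lambda>i. pseudo_obs M X i \<omega>) k l v - C v
    = sqrt (real n) / real_of_int (l - k + 1)
      * (seq_emp_process M C X n \<omega> 0 t v - seq_emp_process M C X n \<omega> 0 s v)"
proof -
  let ?f = "\<lambda>i. of_bool (pseudo_obs M X i \<omega> \<le> v) - C v"
  have "0 \<le> real n * s" using assms by simp
  then have "1 \<le> k" using assms(3) by simp
  then have "{1..l} = {1..k - 1} \<union> {k..l}" "{1..k - 1} \<inter> {k..l} = {}"
    using \<open>k \<le> l\<close> by auto
  then have "sum ?f {1..l} = sum ?f {1..k - 1} + sum ?f {k..l}"
    by (simp add: sum.union_disjoint)
  then have "seq_emp_process M C X n \<omega> 0 t v - seq_emp_process M C X n \<omega> 0 s v = sum ?f {k..l} / sqrt (real n)"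
    using assms by (simp add: seq_emp_process_def diff_divide_distrib[symmetric])
  moreover have "sum ?f {k..l} = real_of_int (l - k + 1) * (edf (\<lambda>i. pseudo_obs M X i \<omega>) k l v - C v)"
  proof -
    have "real_of_int (l - k + 1) \<noteq> 0" using \<open>k \<le> l\<close> by (simp del: of_int_add of_int_diff)
    moreover have "real (nat (l - k + 1)) = real_of_int (l - k + 1)" using \<open>k \<le> l\<close> by simp
    ultimately show ?thesis
      by (simp add: edf_def sum_subtractf right_diff_distrib del: of_int_add of_int_diff sum_of_bool_eq)
  qed
  moreover have "real_of_int (l - k + 1) \<noteq> 0" using \<open>k \<le> l\<close> by (simp del: of_int_add of_int_diff)
  ultimately show ?thesis using \<open>0 < n\<close> by (simp del: of_int_add of_int_diff)
qed

text \<open>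
  Both suprema are over nonempty sets, so the supremum error is nonnegative and a pointwise bound
  suffices in spite of the absolute value in \<open>small_o_Pr\<close>.
\<close>

lemma small_o_Pr_sup_error:
  assumes "0 < \<delta>" "\<delta> < 1" "0 < \<epsilon>" "\<epsilon> < 1 / 2"
    and ev: "\<And>g p. 0 < g \<Longrightarrow> 0 < p \<Longrightarrow> \<forall>\<^sub>F n in sequentially. \<exists>E\<in>sets M. emeasure M E \<le> ennreal p \<and>
      (\<forall>\<omega>\<in>space M - E. \<forall>s t u. 0 \<le> s \<and> s \<le> t \<and> t \<le> 1 \<and> \<delta> \<le> t - s \<and> u \<in> cbox 0 1 \<and> u $ j \<in> {\<epsilon>..1 - \<epsilon>} \<longrightarrow>
        \<bar>D (\<lambda>i. X i \<omega>) j (\<lfloor>real n * s\<rfloor> + 1) \<lfloor>real n * t\<rfloor> u - partial_deriv C j u\<bar> \<le> g)"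
  shows "small_o_Pr M (sup_error C X D j \<delta> \<epsilon>)"
  unfolding small_o_Pr_def
proof (intro allI impI)
  fix g :: real assume "0 < g"
  show "(\<lambda>n. outer_measure_of M {\<omega> \<in> space M. ereal g < \<bar>sup_error C X D j \<delta> \<epsilon> n \<omega>\<bar>}) \<longlonglongrightarrow> 0"
  proof (rule order_tendstoI)
    fix c :: ennreal assume "0 < c"
    then obtain p where p: "0 < p" "ennreal p < c"
      by (cases c) (auto simp: ennreal_less_iff intro: that[of 1] that[of "enn2real c / 2"])
    show "\<forall>\<^sub>F n in sequentially. outer_measure_of M {\<omega> \<in> space M. ereal g < \<bar>sup_error C X D j \<delta> \<epsilon> n \<omega>\<bar>} < c"
      using ev[OF \<open>0 < g\<close> \<open>0 < p\<close>]
    proof eventually_elim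
      case (elim n)
      then obtain E where E: "E \<in> sets M" "emeasure M E \<le> ennreal p"
        and le: "\<And>\<omega> s t u. \<omega> \<in> space M - E \<Longrightarrow> 0 \<le> s \<and> s \<le> t \<and> t \<le> 1 \<and> \<delta> \<le> t - s \<and> u \<in> cbox 0 1 \<and> u $ j \<in> {\<epsilon>..1 - \<epsilon>} \<Longrightarrow>
          \<bar>D (\<lambda>i. X i \<omega>) j (\<lfloor>real n * s\<rfloor> + 1) \<lfloor>real n * t\<rfloor> u - partial_deriv C j u\<bar> \<le> g"
        by blast
      have "{\<omega> \<in> space M. ereal g < \<bar>sup_error C X D j \<delta> \<epsilon> n \<omega>\<bar>} \<subseteq> E"
      proof (rule ccontr)
        assume "\<not> ?thesis"
        then obtain \<omega> where \<omega>: "\<omega> \<in> space M - E" "ereal g < \<bar>sup_error C X D j \<delta> \<epsilon> n \<omega>\<bar>" by auto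
        have "sup_error C X D j \<delta> \<epsilon> n \<omega> \<le> ereal g"
          unfolding sup_error_def using le[OF \<omega>(1)] by (auto intro!: SUP_least)
        moreover have "0 \<le> sup_error C X D j \<delta> \<epsilon> n \<omega>"
          unfolding sup_error_def
          by (rule SUP_upper2[of "(0, 1)"], use assms(1,2) in simp, simp only: prod.case,
            rule SUP_upper2[of "\<chi> i. 1 / 2"]) (use assms in \<open>auto simp: mem_unit_cube\<close>)
        ultimately show False using \<omega>(2) by simp
      qed
      then have "outer_measure_of M {\<omega> \<in> space M. ereal g < \<bar>sup_error C X D j \<delta> \<epsilon> n \<omega>\<bar>} \<le> outer_measure_of M E"
        by (rule outer_measure_of_mono)
      then show ?case using E p by simp
    qed
  qed simp
qed

lemma dist_coordinate:
  fixes v v' :: "real ^ 'd"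
  assumes "\<And>i. i \<noteq> j \<Longrightarrow> v $ i = v' $ i"
  shows "dist v v' = \<bar>v $ j - v' $ j\<bar>"
proof -
  have "v - v' = (v $ j - v' $ j) *\<^sub>R axis j 1"
    using assms by (auto simp: vec_eq_iff axis_def)
  then show ?thesis by (simp add: dist_norm norm_axis_1)
qed

lemma truncation_error_le:
  fixes a c :: real
  assumes "0 \<le> c" "c \<le> 1" "\<bar>a - c\<bar> \<le> g"
  shows "\<bar>min (max a 0) 1 - c\<bar> \<le> g"
  using assms by (auto simp: min_def max_def abs_if split: if_splits)

text \<open>
  Continuity on the slab \<open>0 < u $ j < 1\<close> becomes uniform on a compact slab away from 0 and 1.
\<close>

lemma partial_deriv_uniform_modulus:
  fixes C :: "real ^ 'd \<Rightarrow> real"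
  assumes "continuous_on (partial_region j) (partial_deriv C j)" "0 < \<epsilon>" "0 < \<tau>"
  shows "\<exists>d>0. \<forall>u\<in>cbox 0 1. \<forall>v\<in>cbox 0 1. \<epsilon> \<le> u $ j \<and> u $ j \<le> 1 - \<epsilon> \<and> \<epsilon> \<le> v $ j \<and> v $ j \<le> 1 - \<epsilon> \<and> dist v u < d
    \<longrightarrow> \<bar>partial_deriv C j v - partial_deriv C j u\<bar> \<le> \<tau>"
proof -
  let ?S = "cbox 0 1 \<inter> {u :: real ^ 'd. \<epsilon> \<le> u $ j \<and> u $ j \<le> 1 - \<epsilon>}"
  have "closed {u :: real ^ 'd. \<epsilon> \<le> u $ j \<and> u $ j \<le> 1 - \<epsilon>}"
    by (intro closed_Collect_conj closed_Collect_le continuous_intros)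
  then have "compact ?S" by (intro compact_Int_closed compact_cbox)
  moreover have "continuous_on ?S (partial_deriv C j)"
    by (rule continuous_on_subset[OF assms(1)]) (use \<open>0 < \<epsilon>\<close> in \<open>auto simp: partial_region_def\<close>)
  ultimately have "uniformly_continuous_on ?S (partial_deriv C j)"
    by (rule compact_uniformly_continuous[rotated])
  then obtain d where d: "0 < d" and close: "\<forall>u\<in>?S. \<forall>v\<in>?S. dist v u < d \<longrightarrow> dist (partial_deriv C j v) (partial_deriv C j u) < \<tau>"
    unfolding uniformly_continuous_on_def using \<open>0 < \<tau>\<close> by blast
  have "\<bar>partial_deriv C j v - partial_deriv C j u\<bar> \<le> \<tau>" if "u \<in> ?S" "v \<in> ?S" "dist v u < d" for u v
    using close[rule_format, OF that] by (simp add: dist_real_def)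
  then show ?thesis
    using d by (intro exI[of _ d]) simp
qed

lemma floor_stretch_length:
  fixes s t \<delta> :: real
  assumes "\<delta> \<le> t - s" "4 / \<delta> \<le> real n" "0 < \<delta>"
  shows "\<delta> * real n / 2 \<le> real_of_int (\<lfloor>real n * t\<rfloor> - (\<lfloor>real n * s\<rfloor> + 1) + 1)"
    and "\<lfloor>real n * s\<rfloor> + 1 \<le> \<lfloor>real n * t\<rfloor>"
proof -
  have "4 \<le> \<delta> * real n" using assms by (simp add: field_simps)
  have "real n * \<delta> \<le> real n * (t - s)" using assms by (intro mult_left_mono) auto
  then have "\<delta> * real n - 1 \<le> real_of_int (\<lfloor>real n * t\<rfloor> - \<lfloor>real n * s\<rfloor>)"
    using floor_correct[of "real n * t"] floor_correct[of "real n * s"]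
    unfolding right_diff_distrib of_int_diff mult.commute[of \<delta>] by linarith
  then show *: "\<delta> * real n / 2 \<le> real_of_int (\<lfloor>real n * t\<rfloor> - (\<lfloor>real n * s\<rfloor> + 1) + 1)"
    using \<open>4 \<le> \<delta> * real n\<close> by simp
  then have "0 < real_of_int (\<lfloor>real n * t\<rfloor> - (\<lfloor>real n * s\<rfloor> + 1) + 1)"
    using \<open>4 \<le> \<delta> * real n\<close> by linarith
  then show "\<lfloor>real n * s\<rfloor> + 1 \<le> \<lfloor>real n * t\<rfloor>" by linarith
qed

theorem proposition5p5:
  fixes M :: "'a measure"
    and X :: "int \<Rightarrow> 'a \<Rightarrow> real ^ 'd"
    and C :: "real ^ 'd \<Rightarrow> real"
    and U :: "'a \<Rightarrow> real ^ 'p"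
    and W :: "(real ^ 'd) list \<Rightarrow> real ^ 'd \<Rightarrow> real ^ 'p \<Rightarrow> real ^ 'd"
    and h h' :: "(real ^ 'd) list \<Rightarrow> real"
    and ZC :: "(real \<times> (real ^ 'd) \<Rightarrow> real) measure"
  assumes prob: "prob_space M"
    and X_meas: "\<And>i. X i \<in> borel_measurable M"
    and X_stat: "strictly_stationary M X"
    and margins: "\<And>i j. continuous_on UNIV (margin_df M (X i) j)"
    and copula: "\<And>i. copula_of M (X i) C"
    and smoothing: "smoothing_scheme M X U W"
    and bandwidths: "\<And>x. x \<noteq> [] \<Longrightarrow> h x \<in> {0..1/2} \<and> h' x \<in> {0..1/2} \<and> h x + h' x > 0"
    and h_meas: "\<And>k l. 1 \<le> k \<Longrightarrow> k \<le> l \<Longrightarrow> (\<lambda>\<omega>. h (stretch (\<lambda>i. X i \<omega>) k l)) \<in> borel_measurable M"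
    and h'_meas: "\<And>k l. 1 \<le> k \<Longrightarrow> k \<le> l \<Longrightarrow> (\<lambda>\<omega>. h' (stretch (\<lambda>i. X i \<omega>) k l)) \<in> borel_measurable M"
    and i: "\<And>j. (\<forall>u\<in>partial_region j. (\<lambda>r. C (u + r *\<^sub>R axis j 1)) differentiable (at 0)) \<and>
                 continuous_on (partial_region j) (partial_deriv C j)"
    and ii: "\<exists>\<kappa>>0. \<forall>n\<ge>1. \<forall>x. length x = n \<longrightarrow> (\<forall>u\<in>cbox 0 1. \<forall>j.
               prob_space.variance M (\<lambda>\<omega>. W x u (U \<omega>) $ j) \<le> \<kappa> * (u $ j) * (1 - u $ j) / real n)"
    and iii_law: "prob_space ZC \<and> sets ZC = sets (borel_of_metric (linf unit_cube_time))"
    and iii_tight: "tight_law (linf unit_cube_time) ZC"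
    and iii_gauss: "centered_gaussian_law unit_cube_time ZC"
    and iii_conc: "AE f in ZC. continuous_on unit_cube_time f \<and>
               (\<forall>s\<in>{0..1}. \<forall>u\<in>cbox 0 1. s = 0 \<or> (\<exists>j. u $ j = 0) \<longrightarrow> f (s, u) = 0) \<and>
               (\<forall>s\<in>{0<..1}. f (s, 1) = 0)"
    and iii_weak: "weakly_converges M
               (\<lambda>n \<omega>. restrict (\<lambda>(s, u). seq_emp_process M C X n \<omega> 0 s u) unit_cube_time)
               (linf unit_cube_time) ZC"
    and iv: "\<exists>(b :: nat \<Rightarrow> real) (b' :: nat \<Rightarrow> real) L1 L2.
               (\<forall>n\<ge>1. b n > 0 \<and> b' n > 0) \<and>
               antimono_on {1..} b \<and> antimono_on {1..} b' \<and> b \<longlonglongrightarrow> 0 \<and> b' \<longlonglongrightarrow> 0 \<and>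
               0 < L1 \<and> L1 \<le> L2 \<and>
               (\<forall>n\<ge>1. b n + b' n \<ge> 1 / sqrt (real n) \<and>
                  (\<forall>x. length x = n \<longrightarrow>
                     L1 * b n \<le> h x \<and> h x \<le> min (L2 * b n) (1/2) \<and>
                     L1 * b' n \<le> h' x \<and> h' x \<le> min (L2 * b' n) (1/2)))"
  shows "\<forall>j. \<forall>\<delta>\<in>{0<..<1}. \<forall>\<epsilon>\<in>{0<..<1/2}.
           small_o_Pr M (sup_error C X (deriv_est_delta (smoothing_law M U W) h h') j \<delta> \<epsilon>) \<and>
           small_o_Pr M (sup_error C X (deriv_est_nabla (smoothing_law M U W) h h') j \<delta> \<epsilon>) \<and>
           small_o_Pr M (sup_error C X (deriv_est_nabla_trunc (smoothing_law M U W) h h') j \<delta> \<epsilon>) \<and>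
           small_o_Pr M (sup_error C X (deriv_est_delta_trunc (smoothing_law M U W) h h') j \<delta> \<epsilon>)"
proof (intro allI ballI)
  fix j and \<delta> \<epsilon> :: real
  assume \<delta>: "\<delta> \<in> {0<..<1}" and \<epsilon>: "\<epsilon> \<in> {0<..<1 / 2}"
  interpret prob_space M by fact
  obtain b b' :: "nat \<Rightarrow> real" and L1 L2 where bpos: "\<forall>n\<ge>1. b n > 0 \<and> b' n > 0"
    and b0: "b \<longlonglongrightarrow> 0" "b' \<longlonglongrightarrow> 0" and L1: "0 < L1" "L1 \<le> L2"
    and bh: "\<forall>n\<ge>1. b n + b' n \<ge> 1 / sqrt (real n) \<and>
      (\<forall>x. length x = n \<longrightarrow> L1 * b n \<le> h x \<and> h x \<le> min (L2 * b n) (1/2) \<and>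
        L1 * b' n \<le> h' x \<and> h' x \<le> min (L2 * b' n) (1/2))"
    using iv by (elim exE conjE) (rule that)
  have bsum: "1 / sqrt (real n) \<le> b n + b' n" if "1 \<le> n" for n
    using bh that by blast
  have hb: "L1 * b (length x) \<le> h x \<and> h x \<le> L2 * b (length x)
      \<and> L1 * b' (length x) \<le> h' x \<and> h' x \<le> L2 * b' (length x)" if "1 \<le> length x" for x
  proof -
    have "h x \<le> min (L2 * b (length x)) (1/2)" "h' x \<le> min (L2 * b' (length x)) (1/2)"
      "L1 * b (length x) \<le> h x" "L1 * b' (length x) \<le> h' x"
      using bh that by blast+
    then show ?thesis by simp
  qed
  obtain \<kappa> where \<kappa>: "0 < \<kappa>" and var: "\<And>x u i. x \<noteq> [] \<Longrightarrow> u \<in> cbox 0 1 \<Longrightarrow>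
      variance (\<lambda>\<omega>. W x u (U \<omega>) $ i) \<le> \<kappa> * (u $ i) * (1 - u $ i) / real (length x)"
  proof -
    obtain \<kappa> where \<kappa>: "\<kappa> > 0" and var: "\<forall>n\<ge>1. \<forall>x. length x = n \<longrightarrow> (\<forall>u\<in>cbox 0 1. \<forall>j.
        variance (\<lambda>\<omega>. W x u (U \<omega>) $ j) \<le> \<kappa> * (u $ j) * (1 - u $ j) / real n)"
      using ii by blast
    show ?thesis
    proof (rule that[OF \<kappa>])
      fix x :: "(real ^ 'd) list" and u :: "real ^ 'd" and i
      assume "x \<noteq> []" "u \<in> cbox 0 1"
      moreover from this have "1 \<le> length x" by (simp add: Suc_le_eq)
      ultimately show "variance (\<lambda>\<omega>. W x u (U \<omega>) $ i) \<le> \<kappa> * (u $ i) * (1 - u $ i) / real (length x)"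
        using var by blast
    qed
  qed
  have C: "is_copula C" using copula[of 0] by (simp add: copula_of_def)
  have diff: "\<And>u. u \<in> partial_region j \<Longrightarrow> (\<lambda>r. C (u + r *\<^sub>R axis j 1)) differentiable (at 0)"
    and contC: "continuous_on (partial_region j) (partial_deriv C j)"
    using i by blast+
  let ?T = "unit_cube_time :: (real \<times> (real ^ 'd)) set"
  let ?Z = "\<lambda>n \<omega>. restrict (\<lambda>(s, u). seq_emp_process M C X n \<omega> 0 s u) ?T"
  have T0: "(0, 0) \<in> ?T" by (simp add: unit_cube_time_def mem_unit_cube)
  then have T: "compact ?T" "?T \<noteq> {}" "(0, 0) \<in> ?T"
    by (auto simp: unit_cube_time_def intro!: compact_Times)
  have Zcont: "AE f in ZC. continuous_on ?T f" using iii_conc by eventually_elim blast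
  have ZC: "prob_space ZC" "sets ZC = sets (borel_of_metric (linf ?T))" using iii_law by auto

  have main: "\<forall>\<^sub>F n in sequentially. \<exists>E\<in>sets M. emeasure M E \<le> ennreal p \<and>
      (\<forall>\<omega>\<in>space M - E. \<forall>s t u. 0 \<le> s \<and> s \<le> t \<and> t \<le> 1 \<and> \<delta> \<le> t - s \<and> u \<in> cbox 0 1 \<and> u $ j \<in> {\<epsilon>..1 - \<epsilon>} \<longrightarrow>
        \<bar>deriv_est_nabla (smoothing_law M U W) h h' (\<lambda>i. X i \<omega>) j (\<lfloor>real n * s\<rfloor> + 1) \<lfloor>real n * t\<rfloor> u
           - partial_deriv C j u\<bar> \<le> g
        \<and> deriv_est_delta (smoothing_law M U W) h h' (\<lambda>i. X i \<omega>) j (\<lfloor>real n * s\<rfloor> + 1) \<lfloor>real n * t\<rfloor> u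
          = deriv_est_nabla (smoothing_law M U W) h h' (\<lambda>i. X i \<omega>) j (\<lfloor>real n * s\<rfloor> + 1) \<lfloor>real n * t\<rfloor> u)"
    if "0 < g" "0 < p" for g p :: real
  proof -
    define A where "A = 1 + \<kappa> / L1\<^sup>2"
    have A: "1 < A" using \<kappa> L1 by (simp add: A_def)
    \<comment> \<open>The four terms of the error bound are each kept at most \<open>g / 8\<close>: \<open>\<tau>\<close> and \<open>z\<close> settle the middle two.\<close>
    define \<tau> where "\<tau> = g / (4 * (1 + A))"
    define z where "z = g / (8 * A)"
    have \<tau>z: "0 < \<tau>" "0 < z" using \<open>0 < g\<close> A by (auto simp: \<tau>_def z_def)
    obtain d where d: "0 < d" and uc: "\<And>u v. u \<in> cbox 0 1 \<Longrightarrow> v \<in> cbox 0 1 \<Longrightarrow> \<epsilon> / 2 \<le> u $ j \<Longrightarrow> u $ j \<le> 1 - \<epsilon> / 2 \<Longrightarrow>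
        \<epsilon> / 2 \<le> v $ j \<Longrightarrow> v $ j \<le> 1 - \<epsilon> / 2 \<Longrightarrow> dist v u < d \<Longrightarrow> \<bar>partial_deriv C j v - partial_deriv C j u\<bar> \<le> \<tau>"
      using partial_deriv_uniform_modulus[OF contC, of "\<epsilon> / 2" \<tau>] \<epsilon> \<tau>z by auto
    \<comment> \<open>The level of oscillation settles the first term; it is fixed before \<open>\<eta>\<close>, which weak convergence then supplies.\<close>
    define a where "a = min 1 (g * L1 * sqrt (\<delta> / 2) / 48)"
    have a: "0 < a" "a \<le> 1" "a \<le> g * L1 * sqrt (\<delta> / 2) / 48"
      using \<open>0 < g\<close> L1 \<delta> by (auto simp: a_def)
    obtain \<eta> where \<eta>: "0 < \<eta>" and ev_osc: "\<forall>\<^sub>F n in sequentially. \<exists>E\<in>sets M. emeasure M E \<le> ennreal (p / 2) \<and>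
      (\<forall>\<omega>\<in>space M - E. \<forall>x\<in>?T. \<forall>x'\<in>?T. dist x x' \<le> \<eta> \<longrightarrow> \<bar>?Z n \<omega> x - ?Z n \<omega> x'\<bar> < a)"
      using weak_limit_equicontinuous[OF prob T(1,2) ZC iii_weak Zcont a(1,2), of "p / 2"] \<open>0 < p\<close> by auto
    obtain B where B: "0 < B" and ev_bdd: "\<forall>\<^sub>F n in sequentially. \<exists>E\<in>sets M. emeasure M E \<le> ennreal (p / 2) \<and>
      (\<forall>\<omega>\<in>space M - E. \<forall>x\<in>?T. \<bar>?Z n \<omega> x - ?Z n \<omega> (0, 0)\<bar> < B)"
      using weak_limit_bounded[OF prob T(1,2) ZC iii_weak Zcont T(3), of "p / 2"] \<open>0 < p\<close> by auto
    define D where "D = real CARD('d)"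
    have D: "0 < D" by (simp add: D_def)
    \<comment> \<open>The localization radius is chosen so that \<open>\<rho> + e \<le> \<theta>\<close>, true for large \<open>n\<close>, implies all smallness conditions.\<close>
    define \<theta> where "\<theta> = min (min (\<eta> / 4) (\<epsilon> / 4)) (d / (4 * D))"
    have \<theta>: "0 < \<theta>" "\<theta> \<le> \<eta> / 4" "\<theta> \<le> \<epsilon> / 4" "\<theta> \<le> d / (4 * D)"
      using \<eta> \<epsilon> d D by (auto simp: \<theta>_def)
    have \<theta>d: "D * (2 * \<theta>) < d"
    proof -
      have "D * (2 * \<theta>) \<le> D * (2 * (d / (4 * D)))" using \<theta> D by (intro mult_left_mono) auto
      also have "\<dots> < d" using D d by simp
      finally show ?thesis .
    qed
    \<comment> \<open>Keeping both \<open>\<kappa> / m\<close> and \<open>\<beta>\<^sup>2\<close> below \<open>c\<close> settles the last term.\<close>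
    define c where "c = z * \<theta>\<^sup>2 * g / (16 * (D + 1))"
    have c: "0 < c" using \<tau>z \<theta> \<open>0 < g\<close> D by (simp add: c_def)
    define \<beta> where "\<beta> = min \<epsilon> (sqrt c)"
    have \<beta>: "0 < \<beta>" "\<beta> \<le> \<epsilon>" using c \<epsilon> by (auto simp: \<beta>_def)
    have \<beta>2: "\<beta>\<^sup>2 \<le> c"
    proof -
      have "\<beta>\<^sup>2 \<le> (sqrt c)\<^sup>2" using \<beta> by (intro power_mono) (auto simp: \<beta>_def)
      then show ?thesis using c by simp
    qed
    have "\<forall>\<^sub>F m in sequentially. b m < \<beta> / L2" "\<forall>\<^sub>F m in sequentially. b' m < \<beta> / L2"
      using b0 \<beta> L1 by (auto intro!: order_tendstoD(2)[of _ 0])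
    moreover have "(\<lambda>m. \<kappa> / real m) \<longlonglongrightarrow> 0" by (rule lim_const_over_n)
    then have "\<forall>\<^sub>F m in sequentially. \<kappa> / real m < c" using c by (rule order_tendstoD(2))
    ultimately have "\<forall>\<^sub>F m in sequentially. b m < \<beta> / L2 \<and> b' m < \<beta> / L2 \<and> \<kappa> / real m < c"
      by eventually_elim simp
    then obtain N where N: "\<And>m. N \<le> m \<Longrightarrow> b m < \<beta> / L2 \<and> b' m < \<beta> / L2 \<and> \<kappa> / real m < c"
      by (auto simp: eventually_sequentially)
    have "(\<lambda>n. 4 * (B + a) / \<delta> / sqrt (real n)) \<longlonglongrightarrow> 0" by real_asymp
    then have ev_small: "\<forall>\<^sub>F n in sequentially. 4 * (B + a) / \<delta> / sqrt (real n) < \<theta>"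
      using \<theta>(1) by (rule order_tendstoD(2))
    have ev_large: "\<forall>\<^sub>F n in sequentially. 4 / \<delta> \<le> real n" "\<forall>\<^sub>F n in sequentially. 2 * real N / \<delta> \<le> real n"
      by real_asymp+
    obtain E0 where "E0 \<in> null_sets M" and iso: "\<And>\<omega> t i j. \<omega> \<in> space M - E0 \<Longrightarrow>
        (X t \<omega> $ j \<le> X i \<omega> $ j \<longleftrightarrow> pseudo_obs M X t \<omega> $ j \<le> pseudo_obs M X i \<omega> $ j)
      \<and> 0 < pseudo_obs M X t \<omega> $ j \<and> pseudo_obs M X t \<omega> $ j \<le> 1"
      using AE_E3[OF AE_pseudo_obs[OF prob X_meas X_stat margins]] by metis
    then have E0: "E0 \<in> sets M" "emeasure M E0 = 0" by auto
    show ?thesis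
      using ev_osc ev_bdd ev_small ev_large eventually_gt_at_top[of 0]
    proof eventually_elim
      case (elim n)
      from elim(1) obtain E1 where E1: "E1 \<in> sets M" "emeasure M E1 \<le> ennreal (p / 2)"
        and osc1: "\<And>\<omega> x x'. \<omega> \<in> space M - E1 \<Longrightarrow> x \<in> ?T \<Longrightarrow> x' \<in> ?T \<Longrightarrow> dist x x' \<le> \<eta> \<Longrightarrow> \<bar>?Z n \<omega> x - ?Z n \<omega> x'\<bar> < a"
        by blast
      from elim(2) obtain E2 where E2: "E2 \<in> sets M" "emeasure M E2 \<le> ennreal (p / 2)"
        and bdd2: "\<And>\<omega> x. \<omega> \<in> space M - E2 \<Longrightarrow> x \<in> ?T \<Longrightarrow> \<bar>?Z n \<omega> x - ?Z n \<omega> (0, 0)\<bar> < B"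
        by blast
      define E where "E = E0 \<union> (E1 \<union> E2)"
      have E: "E \<in> sets M" using E0 E1 E2 by (simp add: E_def)
      have "emeasure M E \<le> emeasure M E0 + (emeasure M E1 + emeasure M E2)"
        unfolding E_def using E0 E1 E2
        by (meson add_left_mono emeasure_subadditive order_trans sets.Un)
      also have "\<dots> \<le> 0 + (ennreal (p / 2) + ennreal (p / 2))"
        using E0 E1 E2 by (intro add_mono) auto
      also have "\<dots> = ennreal p" using \<open>0 < p\<close> by (simp flip: ennreal_plus)
      finally have Ep: "emeasure M E \<le> ennreal p" .
      show ?case
      proof (intro bexI[OF _ E] conjI Ep ballI allI impI)
        fix \<omega> s t u
        assume \<omega>: "\<omega> \<in> space M - E"
          and stu: "0 \<le> s \<and> s \<le> t \<and> t \<le> 1 \<and> \<delta> \<le> t - s \<and> u \<in> cbox 0 1 \<and> u $ j \<in> {\<epsilon>..1 - \<epsilon>}"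
        define k l where "k = \<lfloor>real n * s\<rfloor> + 1" and "l = \<lfloor>real n * t\<rfloor>"
        define m where "m = real_of_int (l - k + 1)"
        define y where "y i = pseudo_obs M X i \<omega>" for i
        define ds where "ds = stretch (\<lambda>i. X i \<omega>) k l"
        have kl: "k \<le> l" and mn: "\<delta> * real n / 2 \<le> m"
          using floor_stretch_length[of \<delta> t s n] stu elim(4) \<delta> by (auto simp: k_def l_def m_def)
        have len: "real (length ds) = m" using kl by (simp add: ds_def stretch_def m_def)
        have m0: "0 < m" 
        proof -
          have "0 < \<delta> * real n / 2" using elim(6) \<delta> by simp
          then show ?thesis using mn by linarith
        qed
        have ds: "ds \<noteq> []" "1 \<le> length ds" using len m0 by (auto simp: Suc_le_eq)
        have Nm: "N \<le> length ds"
        proof -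
          have "real N \<le> \<delta> * real n / 2" using elim(5) \<delta> by (simp add: field_simps)
          then show ?thesis using mn len by simp
        qed
        \<comment> \<open>The factor that turns increments in time of the process into the error of the empirical d.f. of the stretch.\<close>
        define q where "q = sqrt (real n) / m"
        have q: "0 < q" using m0 elim(6) by (simp add: q_def)
        have q1: "q * (2 * (B + a)) \<le> \<theta>"
        proof -
          have "q \<le> sqrt (real n) / (\<delta> * real n / 2)"
            unfolding q_def using mn m0 elim(6) \<delta> by (intro divide_left_mono mult_pos_pos) auto
          also have "\<dots> = 2 / \<delta> / sqrt (real n)"
            using elim(6) \<delta> by (simp add: field_simps)
          finally have "q * (2 * (B + a)) \<le> 2 / \<delta> / sqrt (real n) * (2 * (B + a))"
            using B a by (intro mult_right_mono) auto
          also have "\<dots> = 4 * (B + a) / \<delta> / sqrt (real n)" by simp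
          finally show ?thesis using elim(3) by linarith
        qed
        have q2: "q * sqrt m \<le> 1 / sqrt (\<delta> / 2)"
        proof -
          have "q * sqrt m = sqrt (real n) / sqrt m"
            using m0 by (simp add: q_def field_simps)
          also have "\<dots> \<le> sqrt (real n) / sqrt (\<delta> * real n / 2)"
            using mn m0 elim(6) \<delta> by (intro divide_left_mono mult_pos_pos real_sqrt_le_mono) auto
          also have "\<dots> = 1 / sqrt (\<delta> / 2)"
            using elim(6) \<delta> by (simp add: real_sqrt_mult real_sqrt_divide)
          finally show ?thesis .
        qed
        let ?B = "\<lambda>s v. seq_emp_process M C X n \<omega> 0 s v"
        have edf: "edf y k l v - C v = q * (?B t v - ?B s v)" for v
          unfolding y_def q_def m_def
          by (rule edf_eq_seq_emp_process) (use elim(6) stu kl in \<open>auto simp: k_def l_def\<close>)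
        have B_osc: "\<bar>?B r v - ?B r v'\<bar> \<le> a"
          if "r \<in> {0..1}" "v \<in> cbox 0 1" "v' \<in> cbox 0 1" "dist v v' \<le> \<eta>" for r v v'
          using osc1[of \<omega> "(r, v)" "(r, v')"] that \<omega> by (simp add: E_def unit_cube_time_def dist_prod_def)
        have B_bdd: "\<bar>?B r v\<bar> \<le> B" if "r \<in> {0..1}" "v \<in> cbox 0 1" for r v
          using bdd2[of \<omega> "(r, v)"] that \<omega> by (simp add: E_def unit_cube_time_def seq_emp_process_def mem_unit_cube)
        have st01: "s \<in> {0..1}" "t \<in> {0..1}" using stu by auto
        define \<rho> e where "\<rho> = q * (2 * B)" and "e = q * (2 * a)"
        interpret y: sample_near_copula C y k l \<rho> \<eta> e
        proof
          show "is_copula C" by fact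
          show "pseudo_sample y k l"
            using kl iso[of \<omega>] \<omega> by (auto simp: pseudo_sample_def y_def E_def)
          show "0 < \<eta>" by fact
          show "\<bar>edf y k l v - C v\<bar> \<le> \<rho>" if "v \<in> cbox 0 1" for v
          proof -
            have "\<bar>?B t v - ?B s v\<bar> \<le> 2 * B"
              using B_bdd[OF st01(1) that] B_bdd[OF st01(2) that] by linarith
            then show ?thesis unfolding edf \<rho>_def abs_mult using q by simp
          qed
          show "\<bar>(edf y k l v - C v) - (edf y k l v' - C v')\<bar> \<le> e"
            if v: "v \<in> cbox 0 1" "v' \<in> cbox 0 1" and off: "\<And>i. i \<noteq> j \<Longrightarrow> v $ i = v' $ i" and "\<bar>v $ j - v' $ j\<bar> \<le> \<eta>"
            for v v' j
          proof -
            have "dist v v' \<le> \<eta>" using dist_coordinate[of j v v'] that by simp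
            then have "\<bar>(?B t v - ?B s v) - (?B t v' - ?B s v')\<bar> \<le> 2 * a"
              using B_osc[OF st01(1) v] B_osc[OF st01(2) v] by linarith
            then show ?thesis
              unfolding edf e_def right_diff_distrib[symmetric] abs_mult using q by simp
          qed
        qed
        have \<rho>e: "\<rho> + e \<le> \<theta>" using q1 by (simp add: \<rho>_def e_def algebra_simps)
        define r r' where "r = h ds" and "r' = h' ds"
        have L2: "0 < L2" using L1 by linarith
        have r: "L1 * b (length ds) \<le> r" "r \<le> L2 * b (length ds)"
            "L1 * b' (length ds) \<le> r'" "r' \<le> L2 * b' (length ds)"
          using hb[OF ds(2)] by (auto simp: r_def r'_def)
        have r0: "0 \<le> r" "0 \<le> r'"
        proof -
          have "0 \<le> L1 * b (length ds)" "0 \<le> L1 * b' (length ds)"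
            using bpos[rule_format, OF ds(2)] L1 by auto
          then show "0 \<le> r" "0 \<le> r'" using r by linarith+
        qed
        have r\<beta>: "r \<le> \<beta>" "r' \<le> \<beta>"
          using r N[OF Nm] L2 by (auto simp: field_simps)
        have rL: "L1 / sqrt m \<le> r + r'"
        proof -
          have "L1 * (1 / sqrt m) \<le> L1 * (b (length ds) + b' (length ds))"
            using bsum[OF ds(2)] L1 len by (intro mult_left_mono) auto
          then show ?thesis using r by (simp add: algebra_simps)
        qed
        have u: "u \<in> cbox 0 1" "\<epsilon> \<le> u $ j" "u $ j \<le> 1 - \<epsilon>" using stu by auto
        have \<epsilon>0: "0 < \<epsilon>" using \<epsilon> by simp
        have "\<bar>smooth_increment (smoothing_law M U W) r r' (\<lambda>i. X i \<omega>) j k l u / (r + r') - partial_deriv C j u\<bar>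
          \<le> 3 * e * sqrt m / L1 + \<tau> * (2 + \<kappa> / L1\<^sup>2) / 2 + z * (1 + \<kappa> / L1\<^sup>2)
            + (real CARD('d) + 1) * (\<kappa> / m + \<beta>\<^sup>2) / (z * \<theta>\<^sup>2)"
        proof (rule y.smooth_increment_error[OF prob smoothing _ _ m0 \<kappa> L1(1) diff _ u \<epsilon>0 _ \<theta>(1) \<tau>z(2) _ _ _ r0 r\<beta> \<beta>(2) rL])
          show "emp_copula (\<lambda>i. X i \<omega>) k l = emp_copula y k l"
            by (rule emp_copula_order_invariant) (use iso \<omega> in \<open>auto simp: y_def E_def\<close>)
          show "variance (\<lambda>\<omega>'. W (stretch (\<lambda>i. X i \<omega>) k l) v (U \<omega>') $ i) \<le> \<kappa> * v $ i * (1 - v $ i) / m"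
            if "v \<in> cbox 0 1" for v i
            using var[OF ds(1) that, of i] len by (simp add: ds_def)
          show "\<bar>partial_deriv C j v - partial_deriv C j u\<bar> \<le> \<tau>"
            if "v \<in> cbox 0 1" "\<epsilon> / 2 \<le> v $ j" "v $ j \<le> 1 - \<epsilon> / 2" "dist v u < d" for v
            by (rule uc) (use that u \<epsilon>0 in auto)
          show "0 \<le> \<tau>" using \<tau>z by simp
          show "2 * \<theta> + 2 * (\<rho> + e) \<le> \<eta>" "\<theta> + \<rho> + e \<le> \<epsilon> / 2" using \<rho>e \<theta> by auto
          have "D * (\<theta> + \<rho> + e) \<le> D * (2 * \<theta>)" using \<rho>e D by (intro mult_left_mono) auto
          then show "real CARD('d) * (\<theta> + \<rho> + e) < d" using \<theta>d unfolding D_def by linarith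
        qed
        also have "\<dots> \<le> g / 8 + g / 8 + g / 8 + g / 8"
        proof (intro add_mono)
          have "e * sqrt m = 2 * a * (q * sqrt m)" by (simp add: e_def)
          also have "\<dots> \<le> 2 * (g * L1 * sqrt (\<delta> / 2) / 48) * (1 / sqrt (\<delta> / 2))"
            using a q2 q m0 \<open>0 < g\<close> L1 \<delta> by (intro mult_mono) auto
          also have "\<dots> = g * L1 / 24" using \<delta> by simp
          finally show "3 * e * sqrt m / L1 \<le> g / 8"
            using L1 by (simp add: field_simps)
          show "\<tau> * (2 + \<kappa> / L1\<^sup>2) / 2 \<le> g / 8"
          proof -
            have eq: "2 + \<kappa> / L1\<^sup>2 = 1 + A" by (simp add: A_def)
            show ?thesis unfolding eq \<tau>_def using A by (simp add: field_simps)
          qed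
          show "z * (1 + \<kappa> / L1\<^sup>2) \<le> g / 8"
            unfolding A_def[symmetric] z_def using A by simp
          have "\<kappa> / m + \<beta>\<^sup>2 \<le> 2 * c" using N[OF Nm] \<beta>2 len by simp
          then have "(D + 1) * (\<kappa> / m + \<beta>\<^sup>2) / (z * \<theta>\<^sup>2) \<le> (D + 1) * (2 * c) / (z * \<theta>\<^sup>2)"
            using D \<tau>z \<theta> by (intro divide_right_mono mult_left_mono) auto
          also have "\<dots> = g / 8"
          proof -
            have "x * (2 * (y * g / (16 * x))) / y = g / 8" if "x \<noteq> 0" "y \<noteq> 0" for x y :: real
              using that by (simp add: field_simps)
            from this[of "D + 1" "z * \<theta>\<^sup>2"] show ?thesis
              using D \<tau>z \<theta> by (simp add: c_def)
          qed
          finally show "(real CARD('d) + 1) * (\<kappa> / m + \<beta>\<^sup>2) / (z * \<theta>\<^sup>2) \<le> g / 8"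
            by (simp add: D_def)
        qed
        also have "\<dots> \<le> g" using \<open>0 < g\<close> by simp
        finally show "\<bar>deriv_est_nabla (smoothing_law M U W) h h' (\<lambda>i. X i \<omega>) j (\<lfloor>real n * s\<rfloor> + 1) \<lfloor>real n * t\<rfloor> u
           - partial_deriv C j u\<bar> \<le> g"
          by (simp add: deriv_est_nabla_def Let_def k_def[symmetric] l_def[symmetric] ds_def[symmetric] r_def r'_def)
        \<comment> \<open>The shifted points stay inside the cube, so the two denominators agree.\<close>
        have "min (u $ j + r) 1 - max (u $ j - r') 0 = r + r'"
          using r0 r\<beta> \<beta> u by auto
        then show "deriv_est_delta (smoothing_law M U W) h h' (\<lambda>i. X i \<omega>) j (\<lfloor>real n * s\<rfloor> + 1) \<lfloor>real n * t\<rfloor> u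
          = deriv_est_nabla (smoothing_law M U W) h h' (\<lambda>i. X i \<omega>) j (\<lfloor>real n * s\<rfloor> + 1) \<lfloor>real n * t\<rfloor> u"
          by (simp add: deriv_est_nabla_def deriv_est_delta_def Let_def k_def[symmetric] l_def[symmetric] ds_def[symmetric] r_def r'_def)
      qed
    qed
  qed

  have est: "small_o_Pr M (sup_error C X Est j \<delta> \<epsilon>)"
    if close: "\<And>\<omega> k l u g. u \<in> cbox 0 1 \<Longrightarrow> u $ j \<in> {\<epsilon>..1 - \<epsilon>} \<Longrightarrow>
        \<bar>deriv_est_nabla (smoothing_law M U W) h h' (\<lambda>i. X i \<omega>) j k l u - partial_deriv C j u\<bar> \<le> g \<Longrightarrow>
        deriv_est_delta (smoothing_law M U W) h h' (\<lambda>i. X i \<omega>) j k l u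
          = deriv_est_nabla (smoothing_law M U W) h h' (\<lambda>i. X i \<omega>) j k l u \<Longrightarrow>
        \<bar>Est (\<lambda>i. X i \<omega>) j k l u - partial_deriv C j u\<bar> \<le> g" for Est
  proof (rule small_o_Pr_sup_error)
    fix g p :: real assume "0 < g" "0 < p"
    from main[OF this]
    show "\<forall>\<^sub>F n in sequentially. \<exists>E\<in>sets M. emeasure M E \<le> ennreal p \<and>
      (\<forall>\<omega>\<in>space M - E. \<forall>s t u. 0 \<le> s \<and> s \<le> t \<and> t \<le> 1 \<and> \<delta> \<le> t - s \<and> u \<in> cbox 0 1 \<and> u $ j \<in> {\<epsilon>..1 - \<epsilon>} \<longrightarrow>
        \<bar>Est (\<lambda>i. X i \<omega>) j (\<lfloor>real n * s\<rfloor> + 1) \<lfloor>real n * t\<rfloor> u - partial_deriv C j u\<bar> \<le> g)"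
    proof eventually_elim
      case (elim n)
      then obtain E where E: "E \<in> sets M" "emeasure M E \<le> ennreal p"
        and nabla: "\<And>\<omega> s t u. \<omega> \<in> space M - E \<Longrightarrow>
          0 \<le> s \<and> s \<le> t \<and> t \<le> 1 \<and> \<delta> \<le> t - s \<and> u \<in> cbox 0 1 \<and> u $ j \<in> {\<epsilon>..1 - \<epsilon>} \<Longrightarrow>
          \<bar>deriv_est_nabla (smoothing_law M U W) h h' (\<lambda>i. X i \<omega>) j (\<lfloor>real n * s\<rfloor> + 1) \<lfloor>real n * t\<rfloor> u
           - partial_deriv C j u\<bar> \<le> g
          \<and> deriv_est_delta (smoothing_law M U W) h h' (\<lambda>i. X i \<omega>) j (\<lfloor>real n * s\<rfloor> + 1) \<lfloor>real n * t\<rfloor> u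
            = deriv_est_nabla (smoothing_law M U W) h h' (\<lambda>i. X i \<omega>) j (\<lfloor>real n * s\<rfloor> + 1) \<lfloor>real n * t\<rfloor> u"
        by blast
      show ?case
      proof (intro bexI[OF _ E(1)] conjI E(2) ballI allI impI)
        fix \<omega> s t u
        assume \<omega>: "\<omega> \<in> space M - E"
          and stu: "0 \<le> s \<and> s \<le> t \<and> t \<le> 1 \<and> \<delta> \<le> t - s \<and> u \<in> cbox 0 1 \<and> u $ j \<in> {\<epsilon>..1 - \<epsilon>}"
        then show "\<bar>Est (\<lambda>i. X i \<omega>) j (\<lfloor>real n * s\<rfloor> + 1) \<lfloor>real n * t\<rfloor> u - partial_deriv C j u\<bar> \<le> g"
          by (intro close) (use nabla[OF \<omega> stu] in auto)
      qed
    qed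
  qed (use \<delta> \<epsilon> in auto)
  have c01: "0 \<le> partial_deriv C j u" "partial_deriv C j u \<le> 1"
    if "u \<in> cbox 0 1" "u $ j \<in> {\<epsilon>..1 - \<epsilon>}" for u
    using partial_deriv_copula_bounds[OF diff C that(1)] that(2) \<epsilon> by auto
  show "small_o_Pr M (sup_error C X (deriv_est_delta (smoothing_law M U W) h h') j \<delta> \<epsilon>) \<and>
    small_o_Pr M (sup_error C X (deriv_est_nabla (smoothing_law M U W) h h') j \<delta> \<epsilon>) \<and>
    small_o_Pr M (sup_error C X (deriv_est_nabla_trunc (smoothing_law M U W) h h') j \<delta> \<epsilon>) \<and>
    small_o_Pr M (sup_error C X (deriv_est_delta_trunc (smoothing_law M U W) h h') j \<delta> \<epsilon>)"
    by (intro conjI; rule est)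
      (auto simp: deriv_est_nabla_trunc_def deriv_est_delta_trunc_def intro!: truncation_error_le c01)
qed

end
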